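(* Let $d\geq 2$ and $k\geq 0$ be integers and let $r>0$. Then $$\|F\|_{H^{k}(\mathbb{B}^{d}_{r})}\simeq\|f(|\,\cdot\,|)\|_{H^{k}(\mathbb{B}^{d+2}_{r})}$$ for all corotational maps $F\in C^{\infty}(\overline{\mathbb{B}^{d}_{r}},\mathbb{C}^{d})$ with radial profile $f\in C^{\infty}_{\mathrm{ev}}([0,r])$.
   Context: $\mathbb{B}^{d}_{r}=\{x\in\mathbb{R}^{d}: |x|<r\}$. $C^{\infty}(\overline{\mathbb{B}^{d}_{r}})$ is the space of smooth complex-valued functions on $\mathbb{B}^{d}_{r}$ whose derivatives of all orders are continuous up to the boundary; $C^{\infty}(\overline{\mathbb{B}^{d}_{r}},\mathbb{C}^{d})$ is the space of maps $F=(F_1,\dots,F_d)$ with each component in $C^{\infty}(\overline{\mathbb{B}^{d}_{r}})$. $C^{\infty}_{\mathrm{ev}}([0,r])=\{f\in C^{\infty}([0,r]): f^{(2n+1)}(0)=0\text{ for all integers } n\ge 0\}$ (complex-valued functions, smooth up to the endpoints). A map $F:\mathbb{B}^{d}_{r}\to\mathbb{C}^{d}$, $F(x)=(F_{1}(x),\ldots,F_{d}(x))$, is corotational if there is a function $f:[0,r)\to\mathbb{C}$ such that $F_{i}(x)=x_{i}f(|x|)$ for $i=1,\ldots,d$; $f$ is called the radial profile of $F$. For scalar functions, on a ball of any dimension $m$, $\|\varphi\|_{H^{k}(\mathbb{B}^{m}_{r})}=\big(\sum_{0\le|\alpha|\le k}\|\partial^{\alpha}\varphi\|_{L^{2}(\mathbb{B}^{m}_{r})}^{2}\big)^{1/2}$;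 for maps, $\|F\|_{H^{k}(\mathbb{B}^{d}_{r})}=\big(\sum_{i=1}^{d}\|F_{i}\|_{H^{k}(\mathbb{B}^{d}_{r})}^{2}\big)^{1/2}$. On the right-hand side of the claim, $f(|\,\cdot\,|)$ is the radial function $y\mapsto f(|y|)$ on $\mathbb{B}^{d+2}_{r}\subset\mathbb{R}^{d+2}$. $A\simeq B$ for all $F$ means that there are constants $c,C>0$, independent of $F$ (but allowed to depend on $d,k,r$), with $c\,B\le A\le C\,B$ for all such $F$. *)

theory Defs
  imports "HOL-Analysis.Analysis"
begin

text \<open>
  Functions on the open ball \<open>ball 0 r\<close> are total functions whose values outside the ball
  are irrelevant: every notion below only looks at points of the ball, and partial derivatives
  at such points only depend on the values in the (open) ball.
\<close>

definition partial_deriv ::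
  "'n::finite \<Rightarrow> (real^'n \<Rightarrow> complex) \<Rightarrow> real^'n \<Rightarrow> complex"
  where "partial_deriv i u x = vector_derivative (\<lambda>t. u (x + t *\<^sub>R axis i 1)) (at 0)"

text \<open>
  \<open>C_infinity_cball r\<close> is the space of smooth functions on the open ball all of whose derivatives
  are continuous up to the boundary. The list \<open>js\<close> ranges over all iterated partial derivatives,
  in any order. Differentiability is required explicitly because \<^const>\<open>vector_derivative\<close> is
  total.
\<close>

definition C_infinity_cball :: "real \<Rightarrow> (real^'n::finite \<Rightarrow> complex) set"
  where "C_infinity_cball r = {u. \<forall>js.
    (\<forall>x\<in>ball 0 r. foldr partial_deriv js u differentiable (at x)) \<and>
    (\<exists>g. continuous_on (cball 0 r) g \<and> (\<forall>x\<in>ball 0 r. g x = foldr partial_deriv js u x))}"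

definition C_infinity_cball_map :: "real \<Rightarrow> (real^'n::finite \<Rightarrow> complex^'n) set"
  where "C_infinity_cball_map r = {F. \<forall>i. (\<lambda>x. F x $ i) \<in> C_infinity_cball r}"

text \<open>Derivatives on the closed interval \<open>[0,r]\<close>, one-sided at the endpoints.\<close>

definition nth_deriv_Icc :: "real \<Rightarrow> nat \<Rightarrow> (real \<Rightarrow> complex) \<Rightarrow> real \<Rightarrow> complex"
  where "nth_deriv_Icc r n f = ((\<lambda>g x. vector_derivative g (at x within {0..r})) ^^ n) f"

definition C_infinity_Icc :: "real \<Rightarrow> (real \<Rightarrow> complex) set"
  where "C_infinity_Icc r = {f. \<forall>n. \<forall>x\<in>{0..r}. nth_deriv_Icc r n f differentiable (at x within {0..r})}"

definition C_infinity_ev :: "real \<Rightarrow> (real \<Rightarrow> complex) set"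
  where "C_infinity_ev r = {f \<in> C_infinity_Icc r. \<forall>n. nth_deriv_Icc r (2 * n + 1) f 0 = 0}"

definition corotational_with_profile ::
  "real \<Rightarrow> (real^'n::finite \<Rightarrow> complex^'n) \<Rightarrow> (real \<Rightarrow> complex) \<Rightarrow> bool"
  where "corotational_with_profile r F f \<longleftrightarrow>
    (\<forall>x\<in>ball 0 r. \<forall>i. F x $ i = complex_of_real (x $ i) * f (norm x))"

text \<open>
  The partial derivative for the multi-index \<open>\<alpha>\<close>. A finite index type carries no canonical order,
  so an arbitrary enumeration of it fixes the order of differentiation; on smooth functions
  partial derivatives commute and the choice is immaterial.
\<close>

definition multi_deriv ::
  "('n::finite \<Rightarrow> nat) \<Rightarrow> (real^'n \<Rightarrow> complex) \<Rightarrow> real^'n \<Rightarrow> complex"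
  where "multi_deriv \<alpha> u =
    foldr (\<lambda>i. partial_deriv i ^^ \<alpha> i) (SOME js. distinct js \<and> set js = UNIV) u"

definition multi_indices :: "nat \<Rightarrow> ('n::finite \<Rightarrow> nat) set"
  where "multi_indices k = {\<alpha>. (\<Sum>i\<in>UNIV. \<alpha> i) \<le> k}"

lemma finite_multi_indices: "finite (multi_indices k :: ('n::finite \<Rightarrow> nat) set)"
proof (rule finite_subset)
  show "multi_indices k \<subseteq> PiE (UNIV :: 'n set) (\<lambda>_. {..k})"
  proof
    fix \<alpha> :: "'n \<Rightarrow> nat" assume "\<alpha> \<in> multi_indices k"
    then have "\<alpha> i \<le> k" for i
      using member_le_sum[of i UNIV \<alpha>] by (simp add: multi_indices_def)
    then show "\<alpha> \<in> PiE (UNIV :: 'n set) (\<lambda>_. {..k})" by auto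
  qed
qed (auto intro: finite_PiE)

definition L2_norm_ball :: "real \<Rightarrow> (real^'n::finite \<Rightarrow> complex) \<Rightarrow> real"
  where "L2_norm_ball r u = sqrt (LINT x:ball 0 r|lborel. (norm (u x))\<^sup>2)"

definition sobolev_norm :: "nat \<Rightarrow> real \<Rightarrow> (real^'n::finite \<Rightarrow> complex) \<Rightarrow> real"
  where "sobolev_norm k r u =
    sqrt (\<Sum>\<alpha>\<in>multi_indices k. (L2_norm_ball r (multi_deriv \<alpha> u))\<^sup>2)"

definition sobolev_norm_map :: "nat \<Rightarrow> real \<Rightarrow> (real^'n::finite \<Rightarrow> complex^'n) \<Rightarrow> real"
  where "sobolev_norm_map k r F =
    sqrt (\<Sum>i\<in>UNIV. (sobolev_norm k r (\<lambda>x. F x $ i))\<^sup>2)"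

end

theory Submission imports Defs "HOL-Computational_Algebra.Polynomial" begin

text \<open>
  Write \<open>w\<^sub>0 = f\<close> and \<open>w\<^sub>m\<^sub>+\<^sub>1 = w\<^sub>m' / \<rho>\<close>. Away from the origin every derivative of order \<open>n\<close> of the radial
  function \<open>f(|x|)\<close> is a combination, with universal angular coefficients, of the terms
  \<open>\<rho>\<^sup>2\<^sup>m\<^sup>-\<^sup>n w\<^sub>m(\<rho>)\<close> with \<open>n/2 \<le> m \<le> n\<close> (\<open>multi_deriv_radial\<close>, \<open>radial_deriv_polar\<close>). Conversely these
  terms can be recovered from derivatives along two coordinate axes: on the first axis the linear system is
  triangular, and by continuity it remains invertible in a cone around it
  (\<open>level_energy_le_in_cone\<close>). The terms being radial, integration over that cone is as good as
  integration over the ball. Hence, in any dimension \<open>N \<ge> 2\<close>, the squared Sobolev norm of \<open>f(|x|)\<close> is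
  equivalent to the sum over \<open>n \<le> k\<close> and \<open>n/2 \<le> m \<le> n\<close> of the one-dimensional integrals of
  \<open>\<rho>\<^sup>N\<^sup>-\<^sup>1 (\<rho>\<^sup>2\<^sup>m\<^sup>-\<^sup>n |w\<^sub>m|)\<^sup>2\<close>.

  A corotational map is a gradient: \<open>x\<^sub>i f(|x|)\<close> is the \<open>i\<close>-th partial derivative of the radial
  function with profile \<open>g\<close>, where \<open>g' = \<rho> f\<close>. The same analysis therefore applies to it, with
  derivatives of \<open>g\<close> of orders \<open>1, \<dots>, k + 1\<close>, and since \<open>g' / \<rho> = f\<close> the terms that appear for \<open>g\<close> in dimension
  \<open>d\<close> at level \<open>n + 1\<close> are those for \<open>f\<close> in dimension \<open>d + 2\<close> at level \<open>n\<close>, with identical weights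
  (\<open>energy_integral_primitive\<close>). There is one exception: for odd \<open>n = 2m + 1\<close> the map contributes the additional integral of
  \<open>\<rho>\<^sup>d\<^sup>-\<^sup>1 |w\<^sub>m|\<^sup>2\<close>. It is bounded by terms of levels \<open>2m\<close> and \<open>2m + 1\<close> of the radial function through a Hardy
  inequality (\<open>profile_moment_hardy\<close>). All integrals are finite because the \<open>w\<^sub>m\<close> are bounded,
  which follows from the boundedness of the derivatives of the map
  (\<open>corotational_tower_bounded\<close>).
\<close>

section \<open>Hermite polynomials in a formal variable\<close>

text \<open>
  These are Hermite polynomials in disguise: \<open>exp (- X x\<^sup>2 / 2)\<close> times the \<open>a\<close>-th derivative of
  \<open>exp (X x\<^sup>2 / 2)\<close> with respect to \<open>x\<close>, read as a polynomial in the formal variable \<open>X\<close>. The model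
  behind them is the family of functions \<open>w\<^sub>m(\<rho>) = X\<^sup>m exp (X \<rho>\<^sup>2 / 2)\<close>, on which \<open>\<rho>\<^sup>-\<^sup>1 d/d\<rho>\<close> is
  multiplication by \<open>X\<close>; the power \<open>X\<^sup>m\<close> therefore stands for the \<open>m\<close>-fold application of
  \<open>\<rho>\<^sup>-\<^sup>1 d/d\<rho>\<close> to a radial profile. The truncated \<open>a - 1\<close> is harmless because its term carries the
  factor \<open>a\<close>.
\<close>
fun hermite :: "nat \<Rightarrow> real \<Rightarrow> real poly" where
  "hermite 0 x = 1"
| "hermite (Suc a) x = pCons 0 (smult x (hermite a x) + smult (real a) (hermite (a - 1) x))"

lemma coeff_hermite_has_derivative:
  "((\<lambda>t. coeff (hermite a t) m) has_real_derivative
     coeff (smult (real a) (pCons 0 (hermite (a - 1) x))) m) (at x)"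
proof (induction a arbitrary: m rule: less_induct)
  case (less a)
  show ?case
  proof (cases a)
    case 0
    then show ?thesis by (simp add: coeff_1)
  next
    case (Suc b)
    show ?thesis
    proof (cases m)
      case 0
      then show ?thesis using Suc by simp
    next
      case (Suc k)
      have D1: "((\<lambda>t. coeff (hermite b t) k) has_real_derivative
          coeff (smult (real b) (pCons 0 (hermite (b - 1) x))) k) (at x)"
        using less[of b] \<open>a = Suc b\<close> by simp
      have D2: "((\<lambda>t. coeff (hermite (b - 1) t) k) has_real_derivative
          coeff (smult (real (b - 1)) (pCons 0 (hermite (b - 1 - 1) x))) k) (at x)"
        using less[of "b - 1"] \<open>a = Suc b\<close> by simp
      have eq: "x * coeff (smult (real b) (pCons 0 (hermite (b - 1) x))) k
          + real b * coeff (smult (real (b - 1)) (pCons 0 (hermite (b - 1 - 1) x))) k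
          = real b * coeff (hermite b x) k"
        by (cases b; cases k) (auto simp: algebra_simps)
      have "((\<lambda>t. t * coeff (hermite b t) k + real b * coeff (hermite (b - 1) t) k) has_real_derivative
          coeff (hermite b x) k + real b * coeff (hermite b x) k) (at x)"
        by (rule derivative_eq_intros D1 D2 refl)+ (use eq in \<open>simp add: algebra_simps\<close>)
      then show ?thesis
        using \<open>a = Suc b\<close> \<open>m = Suc k\<close> by (simp add: algebra_simps)
    qed
  qed
qed

lemma continuous_coeff_hermite:
  assumes "continuous_on S g"
  shows "continuous_on S (\<lambda>x. coeff (hermite a (g x)) m)"
proof -
  have "continuous_on UNIV (\<lambda>t. coeff (hermite a t) m)"
    by (intro continuous_at_imp_continuous_on ballI DERIV_isCont) (rule coeff_hermite_has_derivative)
  from continuous_on_compose2[OF this assms] show ?thesis by simp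
qed

text \<open>
  Scaling \<open>x\<close> by \<open>s\<close> and \<open>X\<close> by \<open>s\<^sup>-\<^sup>2\<close> leaves the exponent \<open>X x\<^sup>2 / 2\<close> of the generating Gaussian
  unchanged. Coefficientwise this is the homogeneity of degree \<open>2m - a\<close> that allows all estimates
  below to be made on the unit sphere.
\<close>
lemma hermite_homogeneous:
  "smult (s ^ a) (hermite a (s * x)) = hermite a x \<circ>\<^sub>p [:0, s\<^sup>2:]"
proof (induction a rule: less_induct)
  case (less a)
  show ?case
  proof (cases a)
    case 0
    then show ?thesis by (simp add: pcompose_1)
  next
    case (Suc b)
    have 1: "smult (s ^ b) (hermite b (s * x)) = hermite b x \<circ>\<^sub>p [:0, s\<^sup>2:]"
      using less Suc by simp
    have 2: "smult (real b * s ^ Suc b) (hermite (b - 1) (s * x))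
        = smult (real b * s\<^sup>2) (hermite (b - 1) x \<circ>\<^sub>p [:0, s\<^sup>2:])"
    proof (cases b)
      case (Suc c)
      have "smult (real b * s ^ Suc b) (hermite (b - 1) (s * x))
          = smult (real b * s\<^sup>2) (smult (s ^ c) (hermite c (s * x)))"
        using Suc by (simp add: power2_eq_square mult_ac)
      also have "smult (s ^ c) (hermite c (s * x)) = hermite c x \<circ>\<^sub>p [:0, s\<^sup>2:]"
        using less[of c] \<open>a = Suc b\<close> Suc by simp
      finally show ?thesis using Suc by simp
    qed simp
    have "smult (s ^ a) (hermite a (s * x)) =
       pCons 0 (smult (s\<^sup>2 * x) (smult (s ^ b) (hermite b (s * x)))
         + smult (real b * s ^ Suc b) (hermite (b - 1) (s * x)))"
      using Suc by (simp add: smult_add_right power2_eq_square mult_ac)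
    also have "\<dots> = hermite a x \<circ>\<^sub>p [:0, s\<^sup>2:]"
      unfolding 1 2 using Suc
      by (simp add: pcompose_pCons pcompose_add pcompose_smult smult_add_right mult_ac)
    finally show ?thesis .
  qed
qed

text \<open>
  In a derivative of total order \<open>n\<close> only the powers \<open>X\<^sup>m\<close> with \<open>n/2 \<le> m \<le> n\<close> occur: each
  differentiation either creates a new factor \<open>X\<close> or uses up one factor \<open>x\<close> that was created
  together with an earlier \<open>X\<close>.
\<close>
definition half_graded :: "nat \<Rightarrow> real poly \<Rightarrow> bool"
  where "half_graded n p \<longleftrightarrow> degree p \<le> n \<and> (\<forall>m. 2 * m < n \<longrightarrow> coeff p m = 0)"

lemma half_graded_mult:
  assumes "half_graded a p" "half_graded b q"
  shows "half_graded (a + b) (p * q)"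
  unfolding half_graded_def
proof (intro conjI allI impI)
  show "degree (p * q) \<le> a + b"
    using assms degree_mult_le[of p q] unfolding half_graded_def by linarith
  fix m assume m: "2 * m < a + b"
  have "coeff p i * coeff q (m - i) = 0" if "i \<le> m" for i
  proof -
    have "2 * i < a \<or> 2 * (m - i) < b" using m that by auto
    then show ?thesis using assms by (auto simp: half_graded_def)
  qed
  then show "coeff (p * q) m = 0" unfolding coeff_mult by (intro sum.neutral) auto
qed

lemma half_graded_hermite: "half_graded a (hermite a x)"
proof (induction a rule: less_induct)
  case (less a)
  show ?case
  proof (cases a)
    case 0
    then show ?thesis by (simp add: half_graded_def)
  next
    case (Suc b)
    have 1: "half_graded b (hermite b x)" "half_graded (b - 1) (hermite (b - 1) x)"
      using less Suc by auto
    have "degree (smult x (hermite b x) + smult (real b) (hermite (b - 1) x)) \<le> b"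
      using 1 by (intro degree_add_le)
        (auto simp: half_graded_def intro: order_trans[OF degree_smult_le])
    then show ?thesis
      using Suc 1 by (auto simp: half_graded_def coeff_pCons split: nat.split)
  qed
qed

lemma hermite_monic_at_1: "coeff (hermite a 1) a = 1"
proof (induction a)
  case (Suc a)
  have "real a * coeff (hermite (a - 1) 1) a = 0"
    using half_graded_hermite[of "a - 1" 1]
    by (cases a) (auto simp: half_graded_def intro!: coeff_eq_0)
  then show ?case using Suc by simp
qed simp

text \<open>
  At the origin only the term in which all differentiations are paired survives; together with the
  previous lemma it makes the system of derivatives along two axes triangular at a point of the
  first axis.
\<close>
lemma hermite_even_at_0: "\<exists>c>0. hermite (2 * j) 0 = monom c j"
proof (induction j)
  case 0
  show ?case by (intro exI[of _ 1]) (simp add: monom_0)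
next
  case (Suc j)
  then obtain c where c: "c > 0" "hermite (2 * j) 0 = monom c j" by blast
  have "hermite (2 * Suc j) 0 = monom (real (2 * j + 1) * c) (Suc j)"
    using c by (simp add: smult_monom monom_Suc)
  then show ?case using c by (intro exI[of _ "real (2 * j + 1) * c"]) auto
qed

definition hermite_prod :: "('n::finite \<Rightarrow> nat) \<Rightarrow> real^'n \<Rightarrow> real poly"
  where "hermite_prod \<alpha> x = (\<Prod>i\<in>UNIV. hermite (\<alpha> i) (x $ i))"

lemma half_graded_prod_hermite:
  assumes "finite A"
  shows "half_graded (\<Sum>i\<in>A. \<alpha> i) (\<Prod>i\<in>A. hermite (\<alpha> i) (y i))"
  using assms
proof (induction A)
  case empty
  then show ?case by (simp add: half_graded_def)
next
  case (insert i A)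
  then show ?case by (simp add: half_graded_mult half_graded_hermite)
qed

lemma half_graded_hermite_prod: "half_graded (\<Sum>i\<in>UNIV. \<alpha> i) (hermite_prod \<alpha> x)"
  unfolding hermite_prod_def by (rule half_graded_prod_hermite) simp

lemma continuous_coeff_hermite_prod:
  "continuous_on S (\<lambda>x. coeff (hermite_prod \<alpha> x) m)"
proof -
  have "continuous_on S (\<lambda>x. coeff (\<Prod>i\<in>A. hermite (\<alpha> i) (x $ i)) m)" if "finite A" for A
    using that
  proof (induction A arbitrary: m)
    case (insert i A)
    then show ?case
      by (simp add: coeff_mult) (intro continuous_intros continuous_coeff_hermite insert.IH)
  qed (auto intro: continuous_intros)
  then show ?thesis unfolding hermite_prod_def by simp
qed

lemma coeff_hermite_prod_scale:
  "s ^ (\<Sum>i\<in>UNIV. \<alpha> i) * coeff (hermite_prod \<alpha> (s *\<^sub>R x)) m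
    = s ^ (2 * m) * coeff (hermite_prod \<alpha> x) m"
proof -
  have "smult (s ^ (\<Sum>i\<in>UNIV. \<alpha> i)) (hermite_prod \<alpha> (s *\<^sub>R x))
      = (\<Prod>i\<in>UNIV. smult (s ^ \<alpha> i) (hermite (\<alpha> i) (s * x $ i)))"
    by (simp add: hermite_prod_def prod_smult power_sum)
  also have "\<dots> = hermite_prod \<alpha> x \<circ>\<^sub>p [:0, s\<^sup>2:]"
    by (simp add: hermite_homogeneous hermite_prod_def pcompose_prod)
  finally have "coeff (smult (s ^ (\<Sum>i\<in>UNIV. \<alpha> i)) (hermite_prod \<alpha> (s *\<^sub>R x))) m
      = coeff (hermite_prod \<alpha> x \<circ>\<^sub>p [:0, s\<^sup>2:]) m" by simp
  then show ?thesis by (simp add: coeff_pcompose_linear power_mult)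
qed

section \<open>Derivatives of radial functions\<close>

text \<open>
  The value that the Gaussian model predicts for the derivative \<open>\<partial>\<^sup>\<alpha>\<close> of \<open>w 0 (norm x)\<close>: each power
  \<open>X\<^sup>m\<close> is replaced by \<open>w m (norm x)\<close>. The formula is symmetric in the order of
  differentiation, which builds in that partial derivatives commute.
\<close>
definition radial_deriv ::
  "(nat \<Rightarrow> real \<Rightarrow> complex) \<Rightarrow> ('n::finite \<Rightarrow> nat) \<Rightarrow> real^'n \<Rightarrow> complex"
  where "radial_deriv w \<alpha> x =
    (\<Sum>m\<le>(\<Sum>i\<in>UNIV. \<alpha> i). coeff (hermite_prod \<alpha> x) m *\<^sub>R w m (norm x))"

text \<open>
  Consecutive profiles are related by \<open>\<rho>\<^sup>-\<^sup>1 d/d\<rho>\<close>, written without division.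
\<close>
definition profile_tower :: "real \<Rightarrow> (nat \<Rightarrow> real \<Rightarrow> complex) \<Rightarrow> bool"
  where "profile_tower r w \<longleftrightarrow>
    (\<forall>m. \<forall>\<rho>\<in>{0<..<r}. (w m has_vector_derivative \<rho> *\<^sub>R w (Suc m) \<rho>) (at \<rho>))"

lemma profile_tower_continuous:
  assumes "profile_tower r w"
  shows "continuous_on {0<..<r} (w m)"
  using assms unfolding profile_tower_def
  by (intro continuous_at_imp_continuous_on ballI has_vector_derivative_continuous) blast

text \<open>
  The recursion of the Hermite polynomials is the product rule: differentiating the coefficients
  produces \<open>a X\<close> times the previous polynomial, and differentiating the profiles multiplies by
  \<open>x\<^sub>i X\<close>, because the factor \<open>x\<^sub>i / \<rho>\<close> from the norm cancels the \<open>\<rho>\<close> in the tower relation.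
\<close>
lemma radial_deriv_has_vector_derivative:
  fixes x :: "real^'n::finite"
  assumes w: "profile_tower r w" and x: "x \<in> ball 0 r - {0}"
  shows "((\<lambda>t. radial_deriv w \<alpha> (x + t *\<^sub>R axis i 1)) has_vector_derivative
     radial_deriv w (\<alpha>(i := Suc (\<alpha> i))) x) (at 0)"
proof -
  define n a R where "n = (\<Sum>i\<in>UNIV. \<alpha> i)" and "a = \<alpha> i"
    and "R = (\<Prod>j\<in>UNIV - {i}. hermite (\<alpha> j) (x $ j))"
  define \<rho> where "\<rho> = norm x"
  define p where "p = hermite a (x $ i)"
  define q where "q = smult (real a) (pCons 0 (hermite (a - 1) (x $ i)))"
  have \<rho>: "0 < \<rho>" "\<rho> < r" using x by (auto simp: \<rho>_def)
  have split: "(\<Prod>j\<in>UNIV. g j) = g i * (\<Prod>j\<in>UNIV - {i}. g j)" for g :: "'n \<Rightarrow> real poly"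
    by (simp add: prod.remove)
  have sums: "(\<Sum>j\<in>UNIV. (\<alpha>(i := Suc (\<alpha> i))) j) = Suc n"
  proof -
    have "(\<Sum>j\<in>UNIV - {i}. (\<alpha>(i := Suc (\<alpha> i))) j) = (\<Sum>j\<in>UNIV - {i}. \<alpha> j)"
      by (rule sum.cong) auto
    then show ?thesis
      unfolding n_def by (simp add: sum.remove[of UNIV i])
  qed
  have line: "hermite_prod \<alpha> (x + t *\<^sub>R axis i 1) = hermite a (x $ i + t) * R" for t
    unfolding hermite_prod_def split R_def a_def
    by (intro arg_cong2[where f="(*)"] prod.cong refl) (auto simp: axis_def)
  have prod_step: "hermite_prod (\<alpha>(i := Suc (\<alpha> i))) x = q * R + pCons 0 (smult (x $ i) (p * R))"
  proof -
    have "hermite_prod (\<alpha>(i := Suc (\<alpha> i))) x = hermite (Suc a) (x $ i) * R"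
      unfolding hermite_prod_def split R_def a_def
      by (intro arg_cong2[where f="(*)"] prod.cong refl) auto
    also have "hermite (Suc a) (x $ i) = q + pCons 0 (smult (x $ i) p)"
      by (simp add: q_def p_def)
    finally show ?thesis by (simp only: distrib_right mult_pCons_left) simp
  qed
  have norm_deriv: "((\<lambda>t. norm (x + t *\<^sub>R axis i 1)) has_real_derivative x $ i / \<rho>) (at 0)"
  proof -
    have "((\<lambda>t. sqrt ((x + t *\<^sub>R axis i 1) \<bullet> (x + t *\<^sub>R axis i 1))) has_real_derivative x $ i / \<rho>) (at 0)"
    proof -
      have "((\<lambda>t. (x \<bullet> x) + 2 * t * x $ i + t\<^sup>2) has_real_derivative 2 * x $ i) (at 0)"
        by (auto intro!: derivative_eq_intros)
      moreover have "(x + t *\<^sub>R axis i 1) \<bullet> (x + t *\<^sub>R axis i 1) = (x \<bullet> x) + 2 * t * x $ i + t\<^sup>2" for t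
        by (simp add: inner_add_left inner_add_right inner_axis inner_commute[of "axis i 1" x]
              inner_axis_axis power2_eq_square algebra_simps)
      ultimately have "((\<lambda>t. (x + t *\<^sub>R axis i 1) \<bullet> (x + t *\<^sub>R axis i 1)) has_real_derivative 2 * x $ i) (at 0)"
        by simp
      from DERIV_real_sqrt[THEN DERIV_chain2, of _ 0 _, OF _ this] \<rho>
      show ?thesis by (simp add: \<rho>_def norm_eq_sqrt_inner field_simps)
    qed
    then show ?thesis by (simp add: norm_eq_sqrt_inner)
  qed
  have w_deriv: "((\<lambda>t. w m (norm (x + t *\<^sub>R axis i 1))) has_vector_derivative
      (x $ i) *\<^sub>R w (Suc m) \<rho>) (at 0)" for m
  proof -
    have "(w m has_vector_derivative \<rho> *\<^sub>R w (Suc m) \<rho>) (at (norm (x + 0 *\<^sub>R axis i 1)))"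
      using w \<rho> by (simp add: profile_tower_def \<rho>_def)
    from vector_diff_chain_at[OF norm_deriv[unfolded has_real_derivative_iff_has_vector_derivative] this]
    show ?thesis using \<rho> by (simp add: o_def)
  qed
  have c_deriv: "((\<lambda>t. coeff (hermite_prod \<alpha> (x + t *\<^sub>R axis i 1)) m) has_real_derivative
      coeff (q * R) m) (at 0)" for m
  proof -
    have "((\<lambda>t. coeff (hermite a (x $ i + t)) l) has_real_derivative coeff q l) (at 0)" for l
    proof -
      have "((\<lambda>t. x $ i + t) has_real_derivative 1) (at 0)"
        by (auto intro!: derivative_eq_intros)
      from DERIV_chain2[of "\<lambda>t. coeff (hermite a t) l", OF _ this]
        coeff_hermite_has_derivative[of a l "x $ i"]
      show ?thesis by (simp add: q_def)
    qed
    then show ?thesis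
      unfolding line coeff_mult by (auto intro!: derivative_eq_intros)
  qed
  \<comment> \<open>The coefficient beyond the degree vanishes along the whole line, hence so does its derivative.\<close>
  have deg: "coeff (q * R) (Suc n) = 0"
  proof -
    have "coeff (hermite_prod \<alpha> (x + t *\<^sub>R axis i 1)) (Suc n) = 0" for t
      using half_graded_hermite_prod[of \<alpha> "x + t *\<^sub>R axis i 1"]
      by (intro coeff_eq_0) (simp add: half_graded_def n_def)
    then have "((\<lambda>t::real. 0) has_real_derivative coeff (q * R) (Suc n)) (at 0)"
      using c_deriv[of "Suc n"] by simp
    then show ?thesis
      using DERIV_const DERIV_unique by blast
  qed
  have "((\<lambda>t. radial_deriv w \<alpha> (x + t *\<^sub>R axis i 1)) has_vector_derivative
     (\<Sum>m\<le>n. coeff (p * R) m *\<^sub>R (x $ i) *\<^sub>R w (Suc m) \<rho> + coeff (q * R) m *\<^sub>R w m \<rho>)) (at 0)"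
  proof -
    have "((\<lambda>t. coeff (hermite_prod \<alpha> (x + t *\<^sub>R axis i 1)) m *\<^sub>R w m (norm (x + t *\<^sub>R axis i 1)))
       has_vector_derivative
       coeff (p * R) m *\<^sub>R (x $ i) *\<^sub>R w (Suc m) \<rho> + coeff (q * R) m *\<^sub>R w m \<rho>) (at 0)" for m
      using has_vector_derivative_scaleR[OF c_deriv[of m] w_deriv[of m]] line[of 0]
      by (simp add: p_def \<rho>_def)
    then show ?thesis
      unfolding radial_deriv_def n_def[symmetric] by (intro has_vector_derivative_sum)
  qed
  also have "(\<Sum>m\<le>n. coeff (p * R) m *\<^sub>R (x $ i) *\<^sub>R w (Suc m) \<rho> + coeff (q * R) m *\<^sub>R w m \<rho>)
     = (\<Sum>m\<le>n. coeff (p * R) m *\<^sub>R (x $ i) *\<^sub>R w (Suc m) \<rho>) + (\<Sum>m\<le>Suc n. coeff (q * R) m *\<^sub>R w m \<rho>)"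
    using deg by (simp add: sum.distrib)
  also have "(\<Sum>m\<le>n. coeff (p * R) m *\<^sub>R (x $ i) *\<^sub>R w (Suc m) \<rho>)
     = (\<Sum>m\<le>Suc n. coeff (pCons 0 (smult (x $ i) (p * R))) m *\<^sub>R w m \<rho>)"
    unfolding sum.atMost_Suc_shift by (simp add: mult.commute)
  also have "\<dots> + (\<Sum>m\<le>Suc n. coeff (q * R) m *\<^sub>R w m \<rho>) = radial_deriv w (\<alpha>(i := Suc (\<alpha> i))) x"
    unfolding radial_deriv_def sums prod_step \<rho>_def[symmetric]
    by (simp only: coeff_add scaleR_add_left sum.distrib add.commute)
  finally show ?thesis .
qed

lemma partial_deriv_cong_open:
  assumes "open S" "x \<in> S" "\<And>y. y \<in> S \<Longrightarrow> u y = v y"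
  shows "partial_deriv i u x = partial_deriv i v x"
proof -
  have "((\<lambda>t. x + t *\<^sub>R axis i 1) \<longlongrightarrow> x + 0 *\<^sub>R axis i (1::real)) (nhds (0::real))"
    by (intro tendsto_add tendsto_scaleR tendsto_const filterlim_ident)
  then have "\<forall>\<^sub>F t in nhds 0. x + t *\<^sub>R axis i (1::real) \<in> S"
    using assms(1,2) by (auto dest: topological_tendstoD)
  then have ev: "\<forall>\<^sub>F t in nhds 0. u (x + t *\<^sub>R axis i 1) = v (x + t *\<^sub>R axis i 1)"
    by eventually_elim (rule assms(3))
  have "((\<lambda>t. u (x + t *\<^sub>R axis i 1)) has_vector_derivative D) (at 0) \<longleftrightarrow>
        ((\<lambda>t. v (x + t *\<^sub>R axis i 1)) has_vector_derivative D) (at 0)" for D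
    by (rule has_vector_derivative_cong_ev) (use ev assms in auto)
  then show ?thesis by (simp add: partial_deriv_def vector_derivative_def)
qed

lemma funpow_partial_deriv_radial:
  assumes w: "profile_tower r w"
    and u: "\<And>x. x \<in> ball 0 r - {0} \<Longrightarrow> u x = radial_deriv w \<beta> x"
    and x: "x \<in> ball 0 r - {0}"
  shows "(partial_deriv i ^^ a) u x = radial_deriv w (\<lambda>j. \<beta> j + (if j = i then a else 0)) x"
  using x
proof (induction a arbitrary: x)
  case 0
  then show ?case using u by simp
next
  case (Suc a)
  have "partial_deriv i ((partial_deriv i ^^ a) u) x
      = partial_deriv i (radial_deriv w (\<lambda>j. \<beta> j + (if j = i then a else 0))) x"
    by (rule partial_deriv_cong_open[of "ball 0 r - {0}"]) (use Suc in auto)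
  also have "\<dots> = radial_deriv w
      ((\<lambda>j. \<beta> j + (if j = i then a else 0))(i := Suc (\<beta> i + (if i = i then a else 0)))) x"
    unfolding partial_deriv_def
    using radial_deriv_has_vector_derivative[OF w Suc.prems] by (rule vector_derivative_at)
  also have "(\<lambda>j. \<beta> j + (if j = i then a else 0))(i := Suc (\<beta> i + (if i = i then a else 0)))
      = (\<lambda>j. \<beta> j + (if j = i then Suc a else 0))" by auto
  finally show ?case by simp
qed

text \<open>
  A function that agrees with one of the derivatives, say of multi-index \<open>\<beta>\<close>, has all of its own
  derivatives in the family. For \<open>\<beta> = 0\<close> this covers radial functions, for a unit vector \<open>\<beta>\<close> the
  components of a corotational map. The origin is excluded since the tower is only given for
  positive radii.
\<close>
lemma multi_deriv_radial:
  fixes u :: "real^'n::finite \<Rightarrow> complex"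
  assumes w: "profile_tower r w"
    and u: "\<And>x. x \<in> ball 0 r - {0} \<Longrightarrow> u x = radial_deriv w \<beta> x"
    and x: "x \<in> ball 0 r - {0}"
  shows "multi_deriv \<alpha> u x = radial_deriv w (\<lambda>j. \<beta> j + \<alpha> j) x"
proof -
  define js where "js = (SOME js. distinct js \<and> set js = (UNIV :: 'n set))"
  have js: "distinct js" "set js = UNIV"
    using someI_ex[OF finite_distinct_list[OF finite_class.finite_UNIV, where 'a1='n]]
    unfolding js_def by (auto simp: conj_commute)
  have "foldr (\<lambda>i. partial_deriv i ^^ \<alpha> i) is u x
      = radial_deriv w (\<lambda>j. \<beta> j + (if j \<in> set is then \<alpha> j else 0)) x" if "distinct is" for "is"
    using that x
  proof (induction "is" arbitrary: x)
    case Nil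
    then show ?case using u by simp
  next
    case (Cons i "is")
    have IH: "foldr (\<lambda>i. partial_deriv i ^^ \<alpha> i) is u y
        = radial_deriv w (\<lambda>j. \<beta> j + (if j \<in> set is then \<alpha> j else 0)) y"
      if "y \<in> ball 0 r - {0}" for y
      using Cons.IH[OF _ that] Cons.prems by simp
    have "foldr (\<lambda>i. partial_deriv i ^^ \<alpha> i) (i # is) u x = radial_deriv w
        (\<lambda>j. (\<beta> j + (if j \<in> set is then \<alpha> j else 0)) + (if j = i then \<alpha> i else 0)) x"
      using funpow_partial_deriv_radial[OF w IH, where x=x and i=i and a="\<alpha> i"] Cons.prems by simp
    also have "(\<lambda>j. (\<beta> j + (if j \<in> set is then \<alpha> j else 0)) + (if j = i then \<alpha> i else 0))
        = (\<lambda>j. \<beta> j + (if j \<in> set (i # is) then \<alpha> j else 0))"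
      using Cons.prems by auto
    finally show ?case .
  qed
  from this[OF js(1)] js(2) show ?thesis by (simp add: multi_deriv_def js_def)
qed

lemma radial_deriv_zero: "radial_deriv w (\<lambda>_. 0) x = w 0 (norm x)"
  by (simp add: radial_deriv_def hermite_prod_def)

lemma radial_deriv_unit:
  "radial_deriv w (\<lambda>j. if j = i then 1 else 0) x = (x $ i) *\<^sub>R w 1 (norm x)"
proof -
  have "hermite_prod (\<lambda>j. if j = i then 1 else 0) x
      = (\<Prod>j\<in>UNIV. if j = i then [:0, x $ i:] else 1)"
    unfolding hermite_prod_def by (rule prod.cong) auto
  also have "\<dots> = [:0, x $ i:]" by simp
  finally show ?thesis by (simp add: radial_deriv_def)
qed

section \<open>Pointwise comparison of derivatives and radial terms\<close>

definition orders :: "nat \<Rightarrow> nat set"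
  where "orders n = {m. n \<le> 2 * m \<and> m \<le> n}"

lemma finite_orders [simp]: "finite (orders n)"
  by (rule finite_subset[of _ "{..n}"]) (auto simp: orders_def)

text \<open>
  This is, up to constants, the sum of the squares of all derivatives of order \<open>n\<close> of a radial
  function at radius \<open>\<rho>\<close>.
\<close>
definition level_energy :: "(nat \<Rightarrow> real \<Rightarrow> complex) \<Rightarrow> nat \<Rightarrow> real \<Rightarrow> real"
  where "level_energy w n \<rho> = (\<Sum>m\<in>orders n. (\<rho> ^ (2 * m - n) * norm (w m \<rho>))\<^sup>2)"

lemma level_energy_nonneg: "level_energy w n \<rho> \<ge> 0"
  unfolding level_energy_def by (intro sum_nonneg) auto

text \<open>
  Homogeneity separates the angular coefficients, which are universal, from the radial factors,
  which are exactly the entries of the level energy.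
\<close>
lemma radial_deriv_polar:
  fixes x :: "real^'n::finite"
  assumes "x \<noteq> 0" and n: "(\<Sum>i\<in>UNIV. \<alpha> i) = n"
  shows "radial_deriv w \<alpha> x = (\<Sum>m\<in>orders n.
    coeff (hermite_prod \<alpha> (sgn x)) m *\<^sub>R (norm x ^ (2 * m - n) *\<^sub>R w m (norm x)))"
proof -
  have x: "x = norm x *\<^sub>R sgn x" using assms by (simp add: sgn_div_norm)
  have c: "coeff (hermite_prod \<alpha> x) m = coeff (hermite_prod \<alpha> (sgn x)) m * norm x ^ (2 * m - n)"
    if "m \<in> orders n" for m
  proof -
    have "norm x ^ n * coeff (hermite_prod \<alpha> x) m = norm x ^ (2 * m) * coeff (hermite_prod \<alpha> (sgn x)) m"
      using coeff_hermite_prod_scale[of "norm x" \<alpha> "sgn x" m] x n by simp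
    also have "norm x ^ (2 * m) = norm x ^ n * norm x ^ (2 * m - n)"
      using that by (simp add: orders_def flip: power_add)
    finally show ?thesis using assms(1) by simp
  qed
  have "radial_deriv w \<alpha> x = (\<Sum>m\<in>orders n. coeff (hermite_prod \<alpha> x) m *\<^sub>R w m (norm x))"
    unfolding radial_deriv_def n
  proof (rule sum.mono_neutral_right)
    show "\<forall>m\<in>{..n} - orders n. coeff (hermite_prod \<alpha> x) m *\<^sub>R w m (norm x) = 0"
    proof
      fix m assume "m \<in> {..n} - orders n"
      then have "2 * m < n" by (auto simp: orders_def)
      then show "coeff (hermite_prod \<alpha> x) m *\<^sub>R w m (norm x) = 0"
        using half_graded_hermite_prod[of \<alpha> x] by (simp add: half_graded_def n)
    qed
  qed (auto simp: orders_def)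
  then show ?thesis using c by simp
qed

lemma sum_squares_le_square_sum:
  fixes z :: "'a \<Rightarrow> real"
  assumes "finite S" "\<And>i. i \<in> S \<Longrightarrow> z i \<ge> 0"
  shows "(\<Sum>i\<in>S. (z i)\<^sup>2) \<le> (\<Sum>i\<in>S. z i)\<^sup>2"
proof -
  have "(\<Sum>i\<in>S. (z i)\<^sup>2) \<le> (\<Sum>i\<in>S. z i * (\<Sum>i\<in>S. z i))"
    unfolding power2_eq_square using assms by (intro sum_mono mult_left_mono member_le_sum) auto
  then show ?thesis by (simp add: power2_eq_square sum_distrib_right)
qed

text \<open>The angular coefficients are continuous on the compact unit sphere, hence bounded.\<close>
lemma radial_deriv_le_level_energy:
  fixes \<alpha> :: "'n::finite \<Rightarrow> nat"
  assumes n: "(\<Sum>i\<in>UNIV. \<alpha> i) = n"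
  shows "\<exists>C>0. \<forall>w. \<forall>x\<in>- {0}. (norm (radial_deriv w \<alpha> x))\<^sup>2 \<le> C * level_energy w n (norm x)"
proof -
  define g where "g x = (\<Sum>m\<in>orders n. \<bar>coeff (hermite_prod \<alpha> x) m\<bar>)" for x :: "real^'n"
  have "compact (g ` sphere 0 1)"
    unfolding g_def by (intro compact_continuous_image continuous_intros continuous_coeff_hermite_prod) auto
  then have "bounded (g ` sphere 0 1)" by (rule compact_imp_bounded)
  then obtain B where B: "\<forall>x\<in>sphere 0 1. \<bar>g x\<bar> \<le> B"
    by (auto simp: bounded_iff)
  define C where "C = (\<bar>B\<bar> + 1)\<^sup>2 * (real (card (orders n)) + 1)"
  have "(norm (radial_deriv w \<alpha> x))\<^sup>2 \<le> C * level_energy w n (norm x)" if "x \<noteq> 0" for w and x :: "real^'n"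
  proof -
    let ?z = "\<lambda>m. norm x ^ (2 * m - n) * norm (w m (norm x))"
    have c: "\<bar>coeff (hermite_prod \<alpha> (sgn x)) m\<bar> \<le> \<bar>B\<bar> + 1" if "m \<in> orders n" for m
    proof -
      have "\<bar>coeff (hermite_prod \<alpha> (sgn x)) m\<bar> \<le> g (sgn x)"
        unfolding g_def using that by (intro member_le_sum) auto
      also have "\<dots> \<le> B" using bspec[OF B, of "sgn x"] \<open>x \<noteq> 0\<close> by (simp add: norm_sgn)
      finally show ?thesis by simp
    qed
    have "norm (radial_deriv w \<alpha> x) \<le> (\<Sum>m\<in>orders n. (\<bar>B\<bar> + 1) * ?z m)"
      unfolding radial_deriv_polar[OF that n]
    proof (rule sum_norm_le)
      fix m assume m: "m \<in> orders n"
      have "norm (coeff (hermite_prod \<alpha> (sgn x)) m *\<^sub>R (norm x ^ (2 * m - n) *\<^sub>R w m (norm x)))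
          = \<bar>coeff (hermite_prod \<alpha> (sgn x)) m\<bar> * ?z m" by (simp add: abs_mult)
      also have "\<dots> \<le> (\<bar>B\<bar> + 1) * ?z m" using c[OF m] by (rule mult_right_mono) simp
      finally show "norm (coeff (hermite_prod \<alpha> (sgn x)) m *\<^sub>R (norm x ^ (2 * m - n) *\<^sub>R w m (norm x)))
          \<le> (\<bar>B\<bar> + 1) * ?z m" .
    qed
    then have "norm (radial_deriv w \<alpha> x) \<le> (\<bar>B\<bar> + 1) * (\<Sum>m\<in>orders n. ?z m)"
      by (simp add: sum_distrib_left)
    from power_mono[OF this norm_ge_zero, of 2]
    have "(norm (radial_deriv w \<alpha> x))\<^sup>2 \<le> (\<bar>B\<bar> + 1)\<^sup>2 * (\<Sum>m\<in>orders n. ?z m)\<^sup>2"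
      by (simp only: power_mult_distrib)
    also have "(\<Sum>m\<in>orders n. ?z m)\<^sup>2 \<le> (real (card (orders n)) + 1) * level_energy w n (norm x)"
    proof -
      have "(\<Sum>m\<in>orders n. ?z m)\<^sup>2 \<le> level_energy w n (norm x) * card (orders n)"
        unfolding level_energy_def by (rule sum_squared_le_sum_of_squares)
      then show ?thesis using level_energy_nonneg[of w n "norm x"] by (simp add: algebra_simps)
    qed
    finally show ?thesis by (simp add: C_def mult_left_mono mult.assoc)
  qed
  moreover have "C > 0"
    unfolding C_def by (intro mult_pos_pos zero_less_power) (auto simp: add_nonneg_pos)
  ultimately show ?thesis by blast
qed

text \<open>Forward substitution in a triangular system with non-vanishing diagonal.\<close>
lemma triangular_lower_bound:
  fixes A :: "nat \<Rightarrow> nat \<Rightarrow> real"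
  assumes "finite S" and upper: "\<And>i m. i \<in> S \<Longrightarrow> m \<in> S \<Longrightarrow> i < m \<Longrightarrow> A i m = 0"
    and diag: "\<And>i. i \<in> S \<Longrightarrow> A i i \<noteq> 0"
  shows "\<exists>C>0. \<forall>z :: nat \<Rightarrow> complex.
    (\<Sum>m\<in>S. norm (z m)) \<le> C * (\<Sum>i\<in>S. norm (\<Sum>m\<in>S. A i m *\<^sub>R z m))"
proof -
  define Y where "Y z = (\<Sum>i\<in>S. norm (\<Sum>m\<in>S. A i m *\<^sub>R z m))" for z :: "nat \<Rightarrow> complex"
  have Y0: "Y z \<ge> 0" for z unfolding Y_def by (intro sum_nonneg) auto
  have "\<exists>C\<ge>0. \<forall>z :: nat \<Rightarrow> complex. norm (z m) \<le> C * Y z" if "m \<in> S" for m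
    using that
  proof (induction m rule: less_induct)
    case (less m)
    then have "\<forall>l\<in>{l\<in>S. l < m}. \<exists>C\<ge>0. \<forall>z :: nat \<Rightarrow> complex. norm (z l) \<le> C * Y z" by auto
    from bchoice[OF this] obtain C
      where C: "\<forall>l\<in>{l\<in>S. l < m}. C l \<ge> 0 \<and> (\<forall>z :: nat \<Rightarrow> complex. norm (z l) \<le> C l * Y z)"
      by blast
    define T where "T = {l\<in>S. l < m}"
    define K where "K = (1 + (\<Sum>l\<in>T. \<bar>A m l\<bar> * C l)) / \<bar>A m m\<bar>"
    have fin: "finite T" using assms(1) by (simp add: T_def)
    have "norm (z m) \<le> K * Y z" for z :: "nat \<Rightarrow> complex"
    proof -
      have "(\<Sum>l\<in>S. A m l *\<^sub>R z l) = (\<Sum>l\<in>insert m T. A m l *\<^sub>R z l)"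
      proof (rule sum.mono_neutral_right)
        show "\<forall>l\<in>S - insert m T. A m l *\<^sub>R z l = 0"
        proof
          fix l assume "l \<in> S - insert m T"
          then have "l \<in> S" "m < l" by (auto simp: T_def)
          then show "A m l *\<^sub>R z l = 0" using upper less.prems by simp
        qed
      qed (use assms less in \<open>auto simp: T_def\<close>)
      also have "\<dots> = A m m *\<^sub>R z m + (\<Sum>l\<in>T. A m l *\<^sub>R z l)"
        using fin by (simp add: T_def)
      finally have "A m m *\<^sub>R z m = (\<Sum>l\<in>S. A m l *\<^sub>R z l) - (\<Sum>l\<in>T. A m l *\<^sub>R z l)" by simp
      then have "\<bar>A m m\<bar> * norm (z m) \<le> norm (\<Sum>l\<in>S. A m l *\<^sub>R z l) + norm (\<Sum>l\<in>T. A m l *\<^sub>R z l)"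
        by (metis norm_scaleR norm_triangle_ineq4)
      also have "norm (\<Sum>l\<in>S. A m l *\<^sub>R z l) \<le> Y z"
        unfolding Y_def using assms(1) less.prems
        by (intro member_le_sum[of m S "\<lambda>i. norm (\<Sum>l\<in>S. A i l *\<^sub>R z l)"]) auto
      also have "norm (\<Sum>l\<in>T. A m l *\<^sub>R z l) \<le> (\<Sum>l\<in>T. \<bar>A m l\<bar> * (C l * Y z))"
        by (rule sum_norm_le) (use C in \<open>auto simp: T_def intro!: mult_left_mono\<close>)
      finally have "\<bar>A m m\<bar> * norm (z m) \<le> (1 + (\<Sum>l\<in>T. \<bar>A m l\<bar> * C l)) * Y z"
        by (simp add: algebra_simps sum_distrib_left)
      then show ?thesis
        using diag[OF less.prems] by (simp add: K_def field_simps)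
    qed
    moreover have "K \<ge> 0"
      unfolding K_def using C by (intro divide_nonneg_nonneg add_nonneg_nonneg sum_nonneg mult_nonneg_nonneg) (auto simp: T_def)
    ultimately show ?case by blast
  qed
  then have "\<forall>m\<in>S. \<exists>C\<ge>0. \<forall>z :: nat \<Rightarrow> complex. norm (z m) \<le> C * Y z" by blast
  from bchoice[OF this] obtain C
    where C: "\<forall>m\<in>S. C m \<ge> 0 \<and> (\<forall>z :: nat \<Rightarrow> complex. norm (z m) \<le> C m * Y z)"
    by blast
  have "(\<Sum>m\<in>S. norm (z m)) \<le> ((\<Sum>m\<in>S. C m) + 1) * Y z" for z :: "nat \<Rightarrow> complex"
  proof -
    have "(\<Sum>m\<in>S. norm (z m)) \<le> (\<Sum>m\<in>S. C m * Y z)" using C by (intro sum_mono) auto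
    then show ?thesis using Y0[of z] by (simp add: algebra_simps sum_distrib_left)
  qed
  moreover have "(\<Sum>m\<in>S. C m) + 1 > 0" using C by (intro add_nonneg_pos sum_nonneg) auto
  ultimately show ?thesis unfolding Y_def by blast
qed

text \<open>
  The multi-index that differentiates \<open>2i - n\<close> times along the axis \<open>a\<close> and \<open>2(n - i)\<close> times
  along the axis \<open>b\<close>. On the axis \<open>a\<close> the derivatives along \<open>b\<close> must all be paired, so that
  \<open>w\<^sub>i\<close> is the highest profile which such a derivative involves.
\<close>
definition two_axes_index :: "'n::finite \<Rightarrow> 'n \<Rightarrow> nat \<Rightarrow> nat \<Rightarrow> 'n \<Rightarrow> nat"
  where "two_axes_index a b n i = (\<lambda>l. if l = a then 2 * i - n else if l = b then 2 * (n - i) else 0)"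

lemma sum_two_axes_index:
  assumes "a \<noteq> b" "i \<in> orders n"
  shows "(\<Sum>l\<in>UNIV. two_axes_index a b n i l) = n"
proof -
  have "(\<Sum>l\<in>UNIV. two_axes_index a b n i l) = (\<Sum>l\<in>{a, b}. two_axes_index a b n i l)"
    by (rule sum.mono_neutral_right) (auto simp: two_axes_index_def)
  then show ?thesis using assms by (auto simp: two_axes_index_def orders_def)
qed

lemma hermite_prod_two_axes_at_axis:
  assumes "a \<noteq> b" "i \<in> orders n"
  shows "coeff (hermite_prod (two_axes_index a b n i) (axis a 1)) i \<noteq> 0"
    and "i < m \<Longrightarrow> coeff (hermite_prod (two_axes_index a b n i) (axis a 1)) m = 0"
proof -
  obtain c where c: "c > 0" "hermite (2 * (n - i)) 0 = monom c (n - i)"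
    using hermite_even_at_0 by blast
  have "hermite_prod (two_axes_index a b n i) (axis a 1)
      = (\<Prod>l\<in>{a, b}. hermite (two_axes_index a b n i l) (axis a 1 $ l))"
    unfolding hermite_prod_def
    by (rule prod.mono_neutral_right) (auto simp: two_axes_index_def)
  also have "\<dots> = hermite (2 * i - n) 1 * monom c (n - i)"
    using assms c by (simp add: two_axes_index_def axis_def)
  finally have eq: "hermite_prod (two_axes_index a b n i) (axis a 1)
      = monom c (n - i) * hermite (2 * i - n) 1" by (simp add: mult.commute)
  have "2 * i - n = i - (n - i)" using assms(2) by (auto simp: orders_def)
  then show "coeff (hermite_prod (two_axes_index a b n i) (axis a 1)) i \<noteq> 0"
    using c assms(2) hermite_monic_at_1[of "2 * i - n"]
    unfolding eq coeff_monom_mult by (auto simp: orders_def)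
  assume "i < m"
  then have "2 * i - n < m - (n - i)" using assms(2) by (auto simp: orders_def)
  then have "coeff (hermite (2 * i - n) 1) (m - (n - i)) = 0"
    using half_graded_hermite[of "2 * i - n" 1] by (intro coeff_eq_0) (simp add: half_graded_def)
  then show "coeff (hermite_prod (two_axes_index a b n i) (axis a 1)) m = 0"
    unfolding eq coeff_monom_mult by simp
qed

text \<open>
  At the direction of the axis \<open>a\<close> the derivatives along the two axes form a triangular linear
  system for the radial factors, so they control the level energy there. By continuity
  of the angular coefficients they still do so, with a larger constant, in
  a whole cone of directions around that axis.
\<close>
lemma level_energy_le_in_cone:
  fixes a b :: "'n::finite"
  assumes ab: "a \<noteq> b"
  shows "\<exists>\<delta>>0. \<exists>C>0. \<forall>w. \<forall>x :: real^'n. x \<noteq> 0 \<longrightarrow> norm (sgn x - axis a 1) < \<delta> \<longrightarrow>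
    level_energy w n (norm x) \<le> C * (\<Sum>i\<in>orders n. (norm (radial_deriv w (two_axes_index a b n i) x))\<^sup>2)"
proof -
  define S where "S = orders n"
  have fin: "finite S" by (simp add: S_def)
  define A where "A y i m = coeff (hermite_prod (two_axes_index a b n i) y) m" for y :: "real^'n" and i m
  define e where "e = (axis a 1 :: real^'n)"
  obtain C0 where C0: "C0 > 0" "\<And>z :: nat \<Rightarrow> complex.
      (\<Sum>m\<in>S. norm (z m)) \<le> C0 * (\<Sum>i\<in>S. norm (\<Sum>m\<in>S. A e i m *\<^sub>R z m))"
    using triangular_lower_bound[OF fin, of "A e"] hermite_prod_two_axes_at_axis[OF ab, of _ n]
    unfolding A_def e_def S_def by blast
  \<comment> \<open>The perturbation of the coefficients must cost at most half of what is to be bounded, so that it can be absorbed.\<close>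
  define \<epsilon> where "\<epsilon> = 1 / (2 * C0 * (real (card S) + 1))"
  have \<epsilon>: "\<epsilon> > 0" using C0(1) by (simp add: \<epsilon>_def add_nonneg_pos)
  have C0\<epsilon>: "C0 * (real (card S) * \<epsilon>) \<le> 1 / 2"
  proof -
    have "C0 * (real (card S) * \<epsilon>) = real (card S) / (2 * (real (card S) + 1))"
      using C0(1) by (simp add: \<epsilon>_def)
    also have "\<dots> \<le> 1 / 2" by (simp add: divide_simps)
    finally show ?thesis .
  qed
  have "\<forall>\<^sub>F y in nhds e. \<bar>A y i m - A e i m\<bar> < \<epsilon>" for i m
  proof -
    have "isCont (\<lambda>y. A y i m) e"
      using continuous_coeff_hermite_prod[of UNIV "two_axes_index a b n i" m]
      by (simp add: A_def continuous_on_eq_continuous_at)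
    then have "((\<lambda>y. A y i m) \<longlongrightarrow> A e i m) (nhds e)"
      by (simp add: isCont_def tendsto_nhds_iff)
    then show ?thesis using \<epsilon> by (auto dest: tendstoD simp: dist_real_def)
  qed
  then have "\<forall>\<^sub>F y in nhds e. \<forall>i\<in>S. \<forall>m\<in>S. \<bar>A y i m - A e i m\<bar> < \<epsilon>"
    using fin by (simp add: eventually_ball_finite)
  then obtain \<delta> where \<delta>: "\<delta> > 0" "\<And>y i m. dist y e < \<delta> \<Longrightarrow> i \<in> S \<Longrightarrow> m \<in> S \<Longrightarrow> \<bar>A y i m - A e i m\<bar> < \<epsilon>"
    unfolding eventually_nhds_metric by blast
  define C where "C = (2 * C0)\<^sup>2 * (real (card S) + 1)"
  have "level_energy w n (norm x) \<le> C * (\<Sum>i\<in>S. (norm (radial_deriv w (two_axes_index a b n i) x))\<^sup>2)"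
    if x: "x \<noteq> 0" "norm (sgn x - axis a 1) < \<delta>" for w and x :: "real^'n"
  proof -
    define z where "z m = norm x ^ (2 * m - n) *\<^sub>R w m (norm x)" for m
    define Z where "Z = (\<Sum>m\<in>S. norm (z m))"
    define D where "D i = norm (radial_deriv w (two_axes_index a b n i) x)" for i
    have D: "D i = norm (\<Sum>m\<in>S. A (sgn x) i m *\<^sub>R z m)" if "i \<in> S" for i
      unfolding D_def
      by (subst radial_deriv_polar[OF x(1) sum_two_axes_index[OF ab]])
        (use that in \<open>auto simp: S_def A_def z_def\<close>)
    have row: "norm (\<Sum>m\<in>S. A e i m *\<^sub>R z m) \<le> D i + \<epsilon> * Z" if i: "i \<in> S" for i
    proof -
      have "(\<Sum>m\<in>S. A e i m *\<^sub>R z m) = (\<Sum>m\<in>S. A (sgn x) i m *\<^sub>R z m) - (\<Sum>m\<in>S. (A (sgn x) i m - A e i m) *\<^sub>R z m)"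
        by (simp add: scaleR_diff_left sum_subtractf)
      then have "norm (\<Sum>m\<in>S. A e i m *\<^sub>R z m) \<le> D i + norm (\<Sum>m\<in>S. (A (sgn x) i m - A e i m) *\<^sub>R z m)"
        using D[OF i] by (metis norm_triangle_ineq4)
      also have "norm (\<Sum>m\<in>S. (A (sgn x) i m - A e i m) *\<^sub>R z m) \<le> (\<Sum>m\<in>S. \<epsilon> * norm (z m))"
      proof (rule sum_norm_le)
        fix m assume "m \<in> S"
        then have "\<bar>A (sgn x) i m - A e i m\<bar> \<le> \<epsilon>"
          using \<delta>(2)[of "sgn x" i m] x(2) i by (simp add: dist_norm e_def)
        then show "norm ((A (sgn x) i m - A e i m) *\<^sub>R z m) \<le> \<epsilon> * norm (z m)"
          by (simp add: mult_right_mono)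
      qed
      finally show ?thesis by (simp add: Z_def sum_distrib_left)
    qed
    have "Z \<le> C0 * (\<Sum>i\<in>S. norm (\<Sum>m\<in>S. A e i m *\<^sub>R z m))"
      unfolding Z_def by (rule C0)
    also have "\<dots> \<le> C0 * (\<Sum>i\<in>S. D i + \<epsilon> * Z)"
      using C0(1) row by (intro mult_left_mono sum_mono) auto
    also have "\<dots> = C0 * (\<Sum>i\<in>S. D i) + (C0 * (real (card S) * \<epsilon>)) * Z"
      by (simp add: sum.distrib algebra_simps)
    also have "\<dots> \<le> C0 * (\<Sum>i\<in>S. D i) + 1 / 2 * Z"
      using C0\<epsilon> by (intro add_left_mono mult_right_mono) (auto simp: Z_def sum_nonneg)
    finally have Z: "Z \<le> 2 * C0 * (\<Sum>i\<in>S. D i)" by simp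
    have "level_energy w n (norm x) = (\<Sum>m\<in>S. (norm (z m))\<^sup>2)"
      by (simp add: level_energy_def S_def z_def)
    also have "\<dots> \<le> Z\<^sup>2"
      unfolding Z_def using fin by (intro sum_squares_le_square_sum) auto
    also have "\<dots> \<le> (2 * C0 * (\<Sum>i\<in>S. D i))\<^sup>2"
      using Z by (intro power_mono) (auto simp: Z_def sum_nonneg)
    also have "\<dots> = (2 * C0)\<^sup>2 * (\<Sum>i\<in>S. D i)\<^sup>2" by (simp add: power_mult_distrib)
    also have "\<dots> \<le> (2 * C0)\<^sup>2 * ((\<Sum>i\<in>S. (D i)\<^sup>2) * card S)"
      by (intro mult_left_mono sum_squared_le_sum_of_squares) auto
    also have "\<dots> \<le> C * (\<Sum>i\<in>S. (D i)\<^sup>2)"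
      using C0(1) by (simp add: C_def algebra_simps sum_nonneg)
    finally show ?thesis by (simp add: D_def)
  qed
  moreover have "C > 0" using C0(1) by (simp add: C_def add_nonneg_pos)
  ultimately show ?thesis using \<delta>(1) unfolding S_def by blast
qed

section \<open>Polar coordinates on cones\<close>

lemma emeasure_lborel_scaleR_image:
  fixes A :: "'a::euclidean_space set"
  assumes "A \<in> sets borel" "s > 0"
  shows "emeasure lborel ((\<lambda>x. s *\<^sub>R x) ` A) = ennreal (s ^ DIM('a)) * emeasure lborel A"
proof -
  have img: "(\<lambda>x. s *\<^sub>R x) ` A = (\<lambda>x. (1 / s) *\<^sub>R x) -` A"
    using assms(2) by (force simp: image_iff intro!: bexI[of _ "(1 / s) *\<^sub>R _"])
  have "emeasure lborel ((\<lambda>x. s *\<^sub>R x) ` A)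
      = emeasure (distr lborel borel (\<lambda>x. 0 + (1 / s) *\<^sub>R x)) A"
    using assms(1) by (subst emeasure_distr) (auto simp: img)
  also have "\<dots> = ennreal (s ^ DIM('a)) * (ennreal ((1 / s) ^ DIM('a)) * emeasure (distr lborel borel (\<lambda>x. 0 + (1 / s) *\<^sub>R x)) A)"
  proof -
    have "ennreal (s ^ DIM('a)) * ennreal ((1 / s) ^ DIM('a)) = 1"
      using assms(2) by (simp add: power_divide flip: ennreal_mult)
    then show ?thesis by (simp add: mult.assoc[symmetric])
  qed
  also have "ennreal ((1 / s) ^ DIM('a)) * emeasure (distr lborel borel (\<lambda>x. 0 + (1 / s) *\<^sub>R x)) A
      = emeasure lborel A"
  proof -
    have "emeasure lborel A = emeasure (density (distr lborel borel (\<lambda>x::'a. 0 + (1 / s) *\<^sub>R x))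
        (\<lambda>_. ennreal (\<bar>1 / s\<bar> ^ DIM('a)))) A"
      using assms(2) by (subst lborel_affine[of "1 / s" 0]) auto
    then show ?thesis using assms by (simp add: emeasure_density_const)
  qed
  finally show ?thesis .
qed

text \<open>
  Cones without a condition at the origin, so that they may be open.
\<close>
definition dilation_invariant :: "'a::real_vector set \<Rightarrow> bool"
  where "dilation_invariant K \<longleftrightarrow> (\<forall>x s. s > 0 \<longrightarrow> (s *\<^sub>R x \<in> K \<longleftrightarrow> x \<in> K))"

lemma measure_cone_cball:
  fixes K :: "'a::euclidean_space set"
  assumes "K \<in> sets borel" "dilation_invariant K" "s > 0"
  shows "measure lborel (K \<inter> cball 0 s) = s ^ DIM('a) * measure lborel (K \<inter> cball 0 1)"
proof -
  have "(\<lambda>x. s *\<^sub>R x) ` (K \<inter> cball 0 1) = K \<inter> cball 0 s"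
  proof (intro equalityI subsetI)
    fix y assume y: "y \<in> K \<inter> cball 0 s"
    then have "(1 / s) *\<^sub>R y \<in> K \<inter> cball 0 1"
      using assms by (auto simp: dilation_invariant_def field_simps)
    moreover have "y = s *\<^sub>R ((1 / s) *\<^sub>R y)" using assms(3) by simp
    ultimately show "y \<in> (\<lambda>x. s *\<^sub>R x) ` (K \<inter> cball 0 1)" by blast
  qed (use assms in \<open>auto simp: dilation_invariant_def\<close>)
  then have "emeasure lborel (K \<inter> cball 0 s) = ennreal (s ^ DIM('a)) * emeasure lborel (K \<inter> cball 0 1)"
    using emeasure_lborel_scaleR_image[of "K \<inter> cball 0 1" s] assms by simp
  then show ?thesis
    using assms(3) by (simp add: measure_def enn2real_mult)
qed

lemma finite_measure_bounded_Int:
  fixes K :: "'a::euclidean_space set"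
  shows "emeasure lborel (K \<inter> cball 0 s) < \<infinity>"
  by (rule emeasure_bounded_finite) (simp add: bounded_Int)

text \<open>
  Integration in polar coordinates for radial functions. The volume of a truncated cone of radius
  \<open>s\<close> scales like \<open>s\<close> to the dimension; its derivative in \<open>s\<close> is the density of the distribution
  of the norm. Two measures on the line that agree on all half-lines are equal.
\<close>
lemma cone_polar_measure:
  fixes K :: "'a::euclidean_space set"
  assumes K: "K \<in> sets borel" "dilation_invariant K" and r: "r > 0"
  defines "\<kappa> \<equiv> real DIM('a) * measure lborel (K \<inter> cball 0 1)"
  shows "distr (density lborel (\<lambda>x. ennreal (indicator (K \<inter> ball 0 r) x))) borel norm
    = density lborel (\<lambda>\<rho>. ennreal (indicator {0<..<r} \<rho> * (\<kappa> * \<rho> ^ (DIM('a) - 1))))"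
    (is "?M = ?N")
proof (rule measure_eqI_lessThan)
  have KB: "K \<inter> ball 0 r \<in> sets borel" using K(1) by auto
  let ?v = "measure lborel (K \<inter> cball 0 1)"
  show "sets ?M = sets borel" "sets ?N = sets borel" by auto
  have M: "emeasure ?M {x<..} = emeasure lborel (K \<inter> ball 0 r \<inter> {y. x < norm y})" for x
  proof -
    have "emeasure ?M {x<..} = emeasure (density lborel (\<lambda>x. ennreal (indicator (K \<inter> ball 0 r) x))) {y. x < norm y}"
      by (subst emeasure_distr) (auto simp: vimage_def)
    also have "\<dots> = emeasure lborel (K \<inter> ball 0 r \<inter> {y. x < norm y})"
      using KB by (subst emeasure_density) (auto simp: ennreal_indicator simp flip: indicator_inter_arith)
    finally show ?thesis .
  qed
  have fin: "emeasure lborel (K \<inter> ball 0 r \<inter> {y. x < norm y}) < \<infinity>" for x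
  proof -
    have "emeasure lborel (K \<inter> ball 0 r \<inter> {y. x < norm y}) \<le> emeasure lborel (K \<inter> cball 0 r)"
      using K by (intro emeasure_mono) auto
    then show ?thesis using finite_measure_bounded_Int order_le_less_trans by blast
  qed
  then show "emeasure ?M {x<..} < \<infinity>" for x by (simp add: M)
  define V where "V s = ?v * s ^ DIM('a)" for s
  have V: "(V has_real_derivative \<kappa> * \<rho> ^ (DIM('a) - 1)) (at \<rho>)" for \<rho>
    unfolding V_def \<kappa>_def by (auto intro!: derivative_eq_intros)
  show "emeasure ?M {x<..} = emeasure ?N {x<..}" for x
  proof -
    \<comment> \<open>The half-line is clipped to the interval that carries both measures.\<close>
    define y where "y = min (max x 0) r"
    have y: "0 \<le> y" "y \<le> r" using r by (auto simp: y_def)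
    have N: "emeasure ?N {x<..} = ennreal (V r - V y)"
    proof -
      have "emeasure ?N {x<..} = (\<integral>\<^sup>+\<rho>. ennreal (indicator {0<..<r} \<rho> * (\<kappa> * \<rho> ^ (DIM('a) - 1))) * indicator {x<..} \<rho> \<partial>lborel)"
        by (subst emeasure_density) auto
      also have "\<dots> = (\<integral>\<^sup>+\<rho>. ennreal (\<kappa> * \<rho> ^ (DIM('a) - 1)) * indicator {y..r} \<rho> \<partial>lborel)"
      proof (rule nn_integral_cong_AE)
        have "AE \<rho> in lborel. \<rho> \<noteq> y" "AE \<rho> in lborel. \<rho> \<noteq> r"
          by (rule AE_lborel_singleton)+
        then show "AE \<rho> in lborel. ennreal (indicator {0<..<r} \<rho> * (\<kappa> * \<rho> ^ (DIM('a) - 1))) * indicator {x<..} \<rho>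
            = ennreal (\<kappa> * \<rho> ^ (DIM('a) - 1)) * indicator {y..r} \<rho>"
          by eventually_elim (auto simp: y_def split: split_indicator)
      qed
      also have "\<dots> = ennreal (V r - V y)"
        by (rule nn_integral_FTC_Icc) (use y V in \<open>auto simp: \<kappa>_def intro: has_field_derivative_at_within\<close>)
      finally show ?thesis .
    qed
    have "emeasure lborel (K \<inter> ball 0 r \<inter> {z. x < norm z}) = ennreal (V r - V y)"
    proof -
      have V_eq: "measure lborel (K \<inter> cball 0 s - {0}) = V s" if "s \<ge> 0" for s
      proof -
        have "measure lborel (K \<inter> cball 0 s - {0}) = measure lborel (K \<inter> cball 0 s)"
          by (rule measure_Diff_null_set) (use K in \<open>auto\<close>)
        also have "\<dots> = V s"
        proof (cases "s = 0")
          case True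
          then have "measure lborel (K \<inter> cball 0 s) = 0"
            by (cases "0 \<in> K") auto
          then show ?thesis using True by (simp add: V_def)
        next
          case False
          then show ?thesis using measure_cone_cball[OF K, of s] that by (simp add: V_def)
        qed
        finally show ?thesis .
      qed
      have "measure lborel (K \<inter> ball 0 r \<inter> {z. x < norm z})
          = measure lborel ((K \<inter> cball 0 r - {0}) - (K \<inter> cball 0 y - {0}))"
      proof (rule measure_eq_AE)
        have "sphere (0::'a) r \<in> null_sets lborel"
          using negligible_sphere[of 0 r] by (simp add: negligible_iff_null_sets null_sets_completion_iff)
        then have "AE z in lborel. z \<notin> sphere (0::'a) r" by (rule AE_not_in)
        moreover have "AE z in lborel. z \<noteq> (0::'a)" by (rule AE_lborel_singleton)
        ultimately show "AE z in lborel. z \<in> K \<inter> ball 0 r \<inter> {z. x < norm z} \<longleftrightarrow>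
            z \<in> (K \<inter> cball 0 r - {0}) - (K \<inter> cball 0 y - {0})"
        proof eventually_elim
          case (elim z)
          then have "norm z > 0" "norm z \<noteq> r" by auto
          moreover from this have "x \<le> 0 \<Longrightarrow> x < norm z" by linarith
          ultimately show ?case using r by (auto simp: y_def min_def max_def split: if_splits)
        qed
      qed (use K in auto)
      also have "\<dots> = V r - V y"
      proof -
        have "emeasure lborel (K \<inter> cball 0 r - {0}) < \<infinity>"
          by (rule emeasure_bounded_finite) (auto intro: bounded_subset[OF bounded_cball[of 0 r]])
        then show ?thesis
          using y r K by (subst measure_Diff) (auto simp: V_eq)
      qed
      finally have "measure lborel (K \<inter> ball 0 r \<inter> {z. x < norm z}) = V r - V y" .
      then show ?thesis using fin[of x] by (simp add: emeasure_eq_ennreal_measure)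
    qed
    then show ?thesis using M N by simp
  qed
qed

lemma cone_polar_integral:
  fixes K :: "(real^'n::finite) set" and g :: "real \<Rightarrow> real"
  assumes K: "K \<in> sets borel" "dilation_invariant K" and r: "r > 0"
    and g: "continuous_on {0<..<r} g"
  shows "(LINT x:K \<inter> (ball 0 r - {0})|lborel. g (norm x))
    = CARD('n) * measure lborel (K \<inter> cball 0 1) * (LINT \<rho>:{0<..<r}|lborel. \<rho> ^ (CARD('n) - 1) * g \<rho>)"
proof -
  define \<kappa> where "\<kappa> = real CARD('n) * measure lborel (K \<inter> cball 0 1)"
  have KB: "K \<inter> ball 0 r \<in> sets borel" using K(1) by auto
  define h where "h = (\<lambda>\<rho>. indicator {0<..<r} \<rho> * g \<rho>)"
  have h [measurable]: "h \<in> borel_measurable borel"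
    using borel_measurable_continuous_on_indicator[OF _ g] by (simp add: h_def)
  have "(LINT x:K \<inter> (ball 0 r - {0})|lborel. g (norm x)) = (LINT x|lborel. indicator (K \<inter> ball 0 r) x *\<^sub>R h (norm x))"
    unfolding set_lebesgue_integral_def h_def
    by (intro Bochner_Integration.integral_cong refl) (auto split: split_indicator)
  also have "\<dots> = (LINT x|density lborel (\<lambda>x. ennreal (indicator (K \<inter> ball 0 r) x)). h (norm x))"
    using KB by (subst integral_density) auto
  also have "\<dots> = (LINT \<rho>|distr (density lborel (\<lambda>x. ennreal (indicator (K \<inter> ball 0 r) x))) borel norm. h \<rho>)"
    by (subst integral_distr) auto
  also have "\<dots> = (LINT \<rho>|density lborel (\<lambda>\<rho>. ennreal (indicator {0<..<r} \<rho> * (\<kappa> * \<rho> ^ (CARD('n) - 1)))). h \<rho>)"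
    using cone_polar_measure[OF K r] by (simp add: \<kappa>_def)
  also have "\<dots> = (LINT \<rho>|lborel. (indicator {0<..<r} \<rho> * (\<kappa> * \<rho> ^ (CARD('n) - 1))) *\<^sub>R h \<rho>)"
    by (subst integral_density) (auto simp: \<kappa>_def split: split_indicator)
  also have "\<dots> = (LINT \<rho>|lborel. \<kappa> * (indicator {0<..<r} \<rho> *\<^sub>R (\<rho> ^ (CARD('n) - 1) * g \<rho>)))"
    unfolding h_def by (intro Bochner_Integration.integral_cong refl) (auto split: split_indicator)
  finally show ?thesis unfolding set_lebesgue_integral_def \<kappa>_def by simp
qed

section \<open>A Hardy inequality on an interval\<close>

lemma set_integrable_bounded_continuous:
  fixes h :: "'a::euclidean_space \<Rightarrow> real"
  assumes "open S" "bounded S" "continuous_on S h" "\<And>x. x \<in> S \<Longrightarrow> \<bar>h x\<bar> \<le> B"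
  shows "set_integrable lborel S h"
  unfolding set_integrable_def
proof (rule integrableI_bounded_set[where A=S and B=B])
  show "(\<lambda>x. indicat_real S x *\<^sub>R h x) \<in> borel_measurable lborel"
    using borel_measurable_continuous_on_indicator[of S h] assms by simp
  show "emeasure lborel S < \<infinity>" using assms(2) by (rule emeasure_bounded_finite)
qed (use assms in \<open>auto split: split_indicator\<close>)

lemma set_integrable_sum:
  fixes f :: "'i \<Rightarrow> 'a \<Rightarrow> real"
  assumes "\<And>i. i \<in> I \<Longrightarrow> set_integrable M S (f i)"
  shows "set_integrable M S (\<lambda>x. \<Sum>i\<in>I. f i x)"
  using assms unfolding set_integrable_def scaleR_sum_right
  by (rule Bochner_Integration.integrable_sum)

lemma set_integral_sum:
  fixes f :: "'i \<Rightarrow> 'a \<Rightarrow> real"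
  assumes "\<And>i. i \<in> I \<Longrightarrow> set_integrable M S (f i)"
  shows "(LINT x:S|M. \<Sum>i\<in>I. f i x) = (\<Sum>i\<in>I. LINT x:S|M. f i x)"
  using assms unfolding set_integrable_def set_lebesgue_integral_def scaleR_sum_right
  by (rule Bochner_Integration.integral_sum)

text \<open>
  A Hardy inequality with a zeroth order term in place of boundary conditions. The function
  \<open>\<phi>(\<rho>) = \<rho>\<^sup>d (r - \<rho>) |g(\<rho>)|\<^sup>2\<close> vanishes at both ends of the interval, so its derivative has integral
  zero. The part of the derivative in which \<open>\<rho>\<^sup>d\<close> is differentiated contains
  \<open>d r \<rho>\<^sup>d\<^sup>-\<^sup>1 |g|\<^sup>2\<close>, and Young's inequality absorbs half of it from the remaining terms.
\<close>
lemma hardy_inequality: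
  fixes g g' :: "real \<Rightarrow> complex"
  assumes d: "d \<ge> 1" and r: "r > 0"
    and deriv: "\<And>\<rho>. \<rho> \<in> {0<..<r} \<Longrightarrow> (g has_vector_derivative g' \<rho>) (at \<rho>)"
    and cont: "continuous_on {0<..<r} g'"
    and bound: "\<And>\<rho>. \<rho> \<in> {0<..<r} \<Longrightarrow> norm (g \<rho>) \<le> B"
               "\<And>\<rho>. \<rho> \<in> {0<..<r} \<Longrightarrow> norm (g' \<rho>) \<le> B"
  shows "(LINT \<rho>:{0<..<r}|lborel. \<rho> ^ (d - 1) * (norm (g \<rho>))\<^sup>2)
    \<le> (2 * (real d + 1)\<^sup>2 / (real d * r)\<^sup>2) * (LINT \<rho>:{0<..<r}|lborel. \<rho> ^ (d + 1) * (norm (g \<rho>))\<^sup>2)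
      + (8 / (real d)\<^sup>2) * (LINT \<rho>:{0<..<r}|lborel. \<rho> ^ (d + 1) * (norm (g' \<rho>))\<^sup>2)"
proof -
  let ?I = "{0<..<r}"
  define \<phi> where "\<phi> \<rho> = \<rho> ^ d * (r - \<rho>) * (norm (g \<rho>))\<^sup>2" for \<rho>
  define \<phi>' where "\<phi>' \<rho> = (real d * \<rho> ^ (d - 1) * (r - \<rho>) - \<rho> ^ d) * (norm (g \<rho>))\<^sup>2
      + \<rho> ^ d * (r - \<rho>) * (2 * (g \<rho> \<bullet> g' \<rho>))" for \<rho>
  have contg: "continuous_on ?I g"
    using deriv by (intro continuous_at_imp_continuous_on ballI has_vector_derivative_continuous) blast
  have pow: "\<rho> ^ d = \<rho> * \<rho> ^ (d - 1)" "\<rho> ^ (d + 1) = \<rho>\<^sup>2 * \<rho> ^ (d - 1)" for \<rho> :: real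
    using d by (cases d; simp add: power2_eq_square)+
  have \<phi>_deriv: "(\<phi> has_real_derivative \<phi>' \<rho>) (at \<rho>)" if "\<rho> \<in> ?I" for \<rho>
  proof -
    have "((\<lambda>\<rho>. (norm (g \<rho>))\<^sup>2) has_real_derivative 2 * (g \<rho> \<bullet> g' \<rho>)) (at \<rho>)"
    proof -
      have "(g has_derivative (\<lambda>h. h *\<^sub>R g' \<rho>)) (at \<rho>)"
        using deriv[OF that] by (simp add: has_vector_derivative_def)
      from has_derivative_inner[OF this this]
      have "((\<lambda>\<rho>. g \<rho> \<bullet> g \<rho>) has_derivative (\<lambda>h. (2 * (g \<rho> \<bullet> g' \<rho>)) * h)) (at \<rho>)"
        by (rule has_derivative_eq_rhs) (simp add: fun_eq_iff inner_commute)
      then show ?thesis by (simp add: has_field_derivative_def power2_norm_eq_inner)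
    qed
    note N = this
    show ?thesis
      unfolding \<phi>_def \<phi>'_def
      by (rule derivative_eq_intros N refl)+ (simp add: algebra_simps)
  qed
  \<comment> \<open>Only boundedness of the function is available near the end points; the weight makes the product extend continuously by zero.\<close>
  have \<phi>_int: "(\<phi>' has_integral 0) {0..r}"
  proof -
    have "continuous_on {0..r} (\<lambda>\<rho>. if \<rho> \<in> ?I then \<phi> \<rho> else 0)"
    proof -
      have lim: "((\<lambda>\<rho>. if \<rho> \<in> ?I then \<phi> \<rho> else 0) \<longlongrightarrow> 0) (at x within {0..r})" if "x = 0 \<or> x = r" for x
      proof (rule Lim_null_comparison)
        show "\<forall>\<^sub>F \<rho> in at x within {0..r}. norm (if \<rho> \<in> ?I then \<phi> \<rho> else 0) \<le> \<bar>\<rho> ^ d * (r - \<rho>)\<bar> * B\<^sup>2"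
        proof (rule always_eventually, rule allI)
          fix \<rho>
          show "norm (if \<rho> \<in> ?I then \<phi> \<rho> else 0) \<le> \<bar>\<rho> ^ d * (r - \<rho>)\<bar> * B\<^sup>2"
            using power_mono[OF bound(1)[of \<rho>] norm_ge_zero, of 2]
            by (auto simp: \<phi>_def abs_mult intro!: mult_left_mono)
        qed
        have "((\<lambda>\<rho>. \<bar>\<rho> ^ d * (r - \<rho>)\<bar> * B\<^sup>2) \<longlongrightarrow> \<bar>x ^ d * (r - x)\<bar> * B\<^sup>2) (at x within {0..r})"
          by (intro tendsto_intros)
        then show "((\<lambda>\<rho>. \<bar>\<rho> ^ d * (r - \<rho>)\<bar> * B\<^sup>2) \<longlongrightarrow> 0) (at x within {0..r})"
          using that d by (auto simp: power_0_left)
      qed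
      have "((\<lambda>\<rho>. if \<rho> \<in> ?I then \<phi> \<rho> else 0) \<longlongrightarrow> (if x \<in> ?I then \<phi> x else 0)) (at x within {0..r})"
        if "x \<in> {0..r}" for x
      proof (cases "x \<in> ?I")
        case True
        have "isCont \<phi> x" using \<phi>_deriv[OF True] by (rule DERIV_isCont)
        then have "(\<phi> \<longlongrightarrow> \<phi> x) (at x within {0..r})"
          unfolding isCont_def by (rule tendsto_within_subset) simp
        moreover have "\<forall>\<^sub>F \<rho> in at x within {0..r}. \<phi> \<rho> = (if \<rho> \<in> ?I then \<phi> \<rho> else 0)"
        proof -
          have "\<forall>\<^sub>F \<rho> in nhds x. \<rho> \<in> ?I" using True by (intro eventually_nhds_in_open) auto
          then show ?thesis unfolding eventually_at_filter by eventually_elim auto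
        qed
        ultimately show ?thesis using True by (auto intro: Lim_transform_eventually)
      next
        case False
        then show ?thesis using that lim[of x] by auto
      qed
      then show ?thesis by (simp add: continuous_on_def)
    qed
    then have "(\<phi>' has_integral (if r \<in> ?I then \<phi> r else 0) - (if 0 \<in> ?I then \<phi> 0 else 0)) {0..r}"
    proof (rule fundamental_theorem_of_calculus_interior[rotated])
      fix x assume x: "x \<in> {0<..<r}"
      have "((\<lambda>\<rho>. if \<rho> \<in> ?I then \<phi> \<rho> else 0) has_vector_derivative \<phi>' x) (at x)"
      proof (rule has_vector_derivative_transform_within_open[OF _ _ x])
        show "(\<phi> has_vector_derivative \<phi>' x) (at x)"
          using \<phi>_deriv[OF x] by (simp add: has_real_derivative_iff_has_vector_derivative)
      qed (use x in auto)
      then show "((\<lambda>\<rho>. if \<rho> \<in> ?I then \<phi> \<rho> else 0) has_vector_derivative \<phi>' x) (at x)" .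
    qed (use r in auto)
    then show ?thesis by simp
  qed
  have int: "set_integrable lborel ?I (\<lambda>\<rho>. \<rho> ^ k * (norm (h \<rho>))\<^sup>2)"
    if "continuous_on ?I h" "\<And>\<rho>. \<rho> \<in> ?I \<Longrightarrow> norm (h \<rho>) \<le> B" for k and h :: "real \<Rightarrow> complex"
  proof (rule set_integrable_bounded_continuous[where B="r ^ k * B\<^sup>2"])
    fix \<rho> assume \<rho>: "\<rho> \<in> ?I"
    have "\<rho> ^ k \<le> r ^ k" using \<rho> by (intro power_mono) auto
    moreover have "(norm (h \<rho>))\<^sup>2 \<le> B\<^sup>2" using that(2)[OF \<rho>] by (intro power_mono) auto
    ultimately show "\<bar>\<rho> ^ k * (norm (h \<rho>))\<^sup>2\<bar> \<le> r ^ k * B\<^sup>2"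
      using \<rho> r by (simp add: abs_mult mult_mono)
  qed (use that in \<open>auto intro!: continuous_intros\<close>)
  define e1 where "e1 \<rho> = \<rho> ^ (d - 1) * (norm (g \<rho>))\<^sup>2" for \<rho>
  define e2 where "e2 \<rho> = \<rho> ^ (d + 1) * (norm (g \<rho>))\<^sup>2" for \<rho>
  define e3 where "e3 \<rho> = \<rho> ^ (d + 1) * (norm (g' \<rho>))\<^sup>2" for \<rho>
  have ints: "set_integrable lborel ?I e1" "set_integrable lborel ?I e2" "set_integrable lborel ?I e3"
    unfolding e1_def e2_def e3_def
    by (rule int[OF contg bound(1)] int[OF cont bound(2)]; assumption)+
  define P where "P \<rho> = (real d * r / 2) * e1 \<rho> - ((real d + 1)\<^sup>2 / (real d * r)) * e2 \<rho>
      - (4 * r / real d) * e3 \<rho>" for \<rho>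
  have P_int: "set_integrable lborel ?I P"
    unfolding P_def by (intro set_integral_diff(1) set_integrable_mult_right ints)
  have P_le: "P \<rho> \<le> \<phi>' \<rho>" if \<rho>: "\<rho> \<in> ?I" for \<rho>
  proof -
    define s t where "s = norm (g \<rho>)" and "t = norm (g' \<rho>)"
    define q where "q = \<rho> ^ (d - 1)"
    have pos: "s \<ge> 0" "t \<ge> 0" "q \<ge> 0" "0 < \<rho>" "\<rho> < r" using \<rho> by (auto simp: s_def t_def q_def)
    have d0: "real d > 0" using d by simp
    have inner: "g \<rho> \<bullet> g' \<rho> \<ge> - (s * t)"
      using Cauchy_Schwarz_ineq2[of "g \<rho>" "g' \<rho>"] by (simp add: s_def t_def abs_le_iff)
    have young1: "(real d + 1) * \<rho> * s\<^sup>2 \<le> (real d * r / 4) * s\<^sup>2 + ((real d + 1)\<^sup>2 / (real d * r)) * (\<rho>\<^sup>2 * s\<^sup>2)"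
    proof -
      have "0 \<le> (real d * r / 2 - (real d + 1) * \<rho>)\<^sup>2 / (real d * r) * s\<^sup>2" using d0 r by simp
      also have "\<dots> = (real d * r / 4) * s\<^sup>2 - (real d + 1) * \<rho> * s\<^sup>2 + ((real d + 1)\<^sup>2 / (real d * r)) * (\<rho>\<^sup>2 * s\<^sup>2)"
        using d0 r by (simp add: power2_eq_square field_simps)
      finally show ?thesis by simp
    qed
    have young2: "2 * r * \<rho> * (s * t) \<le> (real d * r / 4) * s\<^sup>2 + (4 * r / real d) * (\<rho>\<^sup>2 * t\<^sup>2)"
    proof -
      have "0 \<le> r / real d * (real d * s / 2 - 2 * \<rho> * t)\<^sup>2" using d0 r by simp
      also have "\<dots> = (real d * r / 4) * s\<^sup>2 - 2 * r * \<rho> * (s * t) + (4 * r / real d) * (\<rho>\<^sup>2 * t\<^sup>2)"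
        using d0 r by (simp add: power2_eq_square field_simps)
      finally show ?thesis by simp
    qed
    have "\<rho> * (r - \<rho>) * (2 * (g \<rho> \<bullet> g' \<rho>)) \<ge> \<rho> * (r - \<rho>) * (- 2 * (s * t))"
      using inner pos by (intro mult_left_mono) auto
    moreover have "\<rho> * (r - \<rho>) * (2 * (s * t)) \<le> \<rho> * r * (2 * (s * t))"
      using pos by (intro mult_right_mono mult_left_mono) auto
    ultimately have cross: "\<rho> * (r - \<rho>) * (2 * (g \<rho> \<bullet> g' \<rho>)) \<ge> - (2 * r * \<rho> * (s * t))"
      by (simp add: algebra_simps)
    have "(real d * r / 2) * s\<^sup>2 - ((real d + 1)\<^sup>2 / (real d * r)) * (\<rho>\<^sup>2 * s\<^sup>2) - (4 * r / real d) * (\<rho>\<^sup>2 * t\<^sup>2)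
        \<le> real d * r * s\<^sup>2 - (real d + 1) * \<rho> * s\<^sup>2 + \<rho> * (r - \<rho>) * (2 * (g \<rho> \<bullet> g' \<rho>))"
    proof -
      have "(real d * r / 2) * s\<^sup>2 = (real d * r * s\<^sup>2) / 2"
        "(real d * r / 4) * s\<^sup>2 = (real d * r * s\<^sup>2) / 4" by simp_all
      then show ?thesis using young1 young2 cross by linarith
    qed
    from mult_left_mono[OF this pos(3)] show ?thesis
      unfolding P_def e1_def e2_def e3_def \<phi>'_def pow q_def[symmetric] s_def[symmetric] t_def[symmetric]
      by (simp add: algebra_simps)
  qed
  have "(LINT \<rho>:?I|lborel. P \<rho>) = integral ?I P"
    using set_borel_integral_eq_integral[OF P_int] by simp
  also have "\<dots> \<le> integral ?I \<phi>'"
  proof (rule integral_le)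
    show "P integrable_on ?I" using set_borel_integral_eq_integral[OF P_int] by simp
    show "\<phi>' integrable_on ?I"
      using \<phi>_int integrable_on_open_interval_real by blast
  qed (use P_le in auto)
  also have "\<dots> = 0"
    using \<phi>_int integral_open_interval_real[of 0 r \<phi>'] by (simp add: integral_unique)
  finally have "(LINT \<rho>:?I|lborel. P \<rho>) \<le> 0" .
  moreover have "(LINT \<rho>:?I|lborel. P \<rho>)
    = (real d * r / 2) * (LINT \<rho>:?I|lborel. e1 \<rho>)
      - ((real d + 1)\<^sup>2 / (real d * r)) * (LINT \<rho>:?I|lborel. e2 \<rho>)
      - (4 * r / real d) * (LINT \<rho>:?I|lborel. e3 \<rho>)"
    unfolding P_def using ints
    by (simp only: set_integral_diff(2) set_integral_diff(1) set_integrable_mult_right set_integral_mult_right)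
  ultimately have main: "(real d * r / 2) * (LINT \<rho>:?I|lborel. e1 \<rho>)
      \<le> ((real d + 1)\<^sup>2 / (real d * r)) * (LINT \<rho>:?I|lborel. e2 \<rho>)
      + (4 * r / real d) * (LINT \<rho>:?I|lborel. e3 \<rho>)" by simp
  have absorb: "u \<le> (2 * c / (real d * r)\<^sup>2) * v + (8 / (real d)\<^sup>2) * w"
    if "(real d * r / 2) * u \<le> (c / (real d * r)) * v + (4 * r / real d) * w" for u v w c
  proof -
    have "2 / (real d * r) * ((real d * r / 2) * u)
        \<le> 2 / (real d * r) * ((c / (real d * r)) * v + (4 * r / real d) * w)"
      using that d r by (intro mult_left_mono) auto
    then show ?thesis using d r by (simp add: power2_eq_square distrib_left)
  qed
  show ?thesis using absorb[OF main] unfolding e1_def e2_def e3_def .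
qed

section \<open>Towers of profiles\<close>

text \<open>
  Coefficients in the expansion
  \<open>(\<rho>\<^sup>-\<^sup>1 d/d\<rho>)\<^sup>m f = \<Sum>\<^sub>l c\<^sub>m\<^sub>l \<rho>\<^sup>l\<^sup>-\<^sup>2\<^sup>m f\<^sup>(\<^sup>l\<^sup>)\<close>.
\<close>
primrec tower_coeff :: "nat \<Rightarrow> nat \<Rightarrow> real" where
  "tower_coeff 0 l = (if l = 0 then 1 else 0)"
| "tower_coeff (Suc m) l = (real l - 2 * real m) * tower_coeff m l
     + (case l of 0 \<Rightarrow> 0 | Suc j \<Rightarrow> tower_coeff m j)"

lemma tower_coeff_eq_0: "m < l \<Longrightarrow> tower_coeff m l = 0"
  by (induction m arbitrary: l) (auto split: nat.split)

lemma nth_deriv_Icc_has_vector_derivative: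
  assumes "f \<in> C_infinity_Icc r" "\<rho> \<in> {0<..<r}"
  shows "(nth_deriv_Icc r l f has_vector_derivative nth_deriv_Icc r (Suc l) f \<rho>) (at \<rho>)"
proof -
  have "nth_deriv_Icc r l f differentiable (at \<rho> within {0..r})"
    using assms by (auto simp: C_infinity_Icc_def)
  then have "(nth_deriv_Icc r l f has_vector_derivative
      vector_derivative (nth_deriv_Icc r l f) (at \<rho> within {0..r})) (at \<rho> within {0..r})"
    by (simp add: vector_derivative_works)
  then show ?thesis
    using assms(2) by (simp add: nth_deriv_Icc_def at_within_Icc_at)
qed

lemma profile_tower_exists:
  assumes f: "f \<in> C_infinity_Icc r"
  shows "\<exists>w. profile_tower r w \<and> w 0 = f"
proof -
  define h where "h l = nth_deriv_Icc r l f" for l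
  define w where "w m \<rho> = (\<Sum>l\<le>m. (tower_coeff m l * \<rho> powi (int l - 2 * int m)) *\<^sub>R h l \<rho>)" for m \<rho>
  have "(w m has_vector_derivative \<rho> *\<^sub>R w (Suc m) \<rho>) (at \<rho>)" if \<rho>: "\<rho> \<in> {0<..<r}" for m \<rho>
  proof -
    define n where "n l = int l - 2 * int m" for l
    have h: "(h l has_vector_derivative h (Suc l) \<rho>) (at \<rho>)" for l
      unfolding h_def using nth_deriv_Icc_has_vector_derivative[OF f \<rho>] .
    have p: "((\<lambda>\<rho>. tower_coeff m l * \<rho> powi n l) has_real_derivative
        tower_coeff m l * (of_int (n l) * \<rho> powi (n l - 1))) (at \<rho>)" for l
      using \<rho> by (auto intro!: derivative_eq_intros)
    have "(w m has_vector_derivative (\<Sum>l\<le>m. (tower_coeff m l * \<rho> powi n l) *\<^sub>R h (Suc l) \<rho>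
        + (tower_coeff m l * (of_int (n l) * \<rho> powi (n l - 1))) *\<^sub>R h l \<rho>)) (at \<rho>)"
      unfolding w_def n_def[symmetric]
      by (intro has_vector_derivative_sum has_vector_derivative_scaleR p h)
    also have "(\<Sum>l\<le>m. (tower_coeff m l * \<rho> powi n l) *\<^sub>R h (Suc l) \<rho>
        + (tower_coeff m l * (of_int (n l) * \<rho> powi (n l - 1))) *\<^sub>R h l \<rho>)
        = (\<Sum>l\<le>m. (tower_coeff m l * \<rho> powi n l) *\<^sub>R h (Suc l) \<rho>)
        + (\<Sum>l\<le>m. (tower_coeff m l * (of_int (n l) * \<rho> powi (n l - 1))) *\<^sub>R h l \<rho>)"
      by (rule sum.distrib)
    also have "(\<Sum>l\<le>m. (tower_coeff m l * \<rho> powi n l) *\<^sub>R h (Suc l) \<rho>)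
        = (\<Sum>l\<le>Suc m. ((case l of 0 \<Rightarrow> 0 | Suc j \<Rightarrow> tower_coeff m j) * \<rho> powi (n l - 1)) *\<^sub>R h l \<rho>)"
      unfolding sum.atMost_Suc_shift by (simp add: n_def)
    also have "(\<Sum>l\<le>m. (tower_coeff m l * (of_int (n l) * \<rho> powi (n l - 1))) *\<^sub>R h l \<rho>)
        = (\<Sum>l\<le>Suc m. (tower_coeff m l * (of_int (n l) * \<rho> powi (n l - 1))) *\<^sub>R h l \<rho>)"
      by (simp add: tower_coeff_eq_0)
    also have "(\<Sum>l\<le>Suc m. ((case l of 0 \<Rightarrow> 0 | Suc j \<Rightarrow> tower_coeff m j) * \<rho> powi (n l - 1)) *\<^sub>R h l \<rho>) + \<dots>
        = (\<Sum>l\<le>Suc m. (tower_coeff (Suc m) l * \<rho> powi (n l - 1)) *\<^sub>R h l \<rho>)"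
      unfolding sum.distrib[symmetric]
      by (intro sum.cong refl) (simp add: n_def algebra_simps)
    also have "\<dots> = \<rho> *\<^sub>R w (Suc m) \<rho>"
    proof -
      have "\<rho> powi (n l - 1) = \<rho> * \<rho> powi (int l - 2 * int (Suc m))" for l
      proof -
        have "n l - 1 = 1 + (int l - 2 * int (Suc m))" by (simp add: n_def)
        moreover have "\<rho> powi (1 + j) = \<rho> * \<rho> powi j" for j
          using power_int_add[of \<rho> 1 j] \<rho> by simp
        ultimately show ?thesis by (simp only:)
      qed
      then show ?thesis
        unfolding w_def by (simp only: scaleR_sum_right scaleR_scaleR mult.left_commute)
    qed
    finally show ?thesis .
  qed
  moreover have "w 0 = f"
    by (simp add: w_def h_def nth_deriv_Icc_def fun_eq_iff)
  ultimately show ?thesis unfolding profile_tower_def by blast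
qed

definition bounded_tower :: "real \<Rightarrow> (nat \<Rightarrow> real \<Rightarrow> complex) \<Rightarrow> bool"
  where "bounded_tower r w \<longleftrightarrow> (\<forall>m. \<exists>B. \<forall>\<rho>\<in>{0<..<r}. norm (w m \<rho>) \<le> B)"

text \<open>A tower with its bottom profile removed is again a tower; adding one is taking a primitive.\<close>
lemma tower_tail:
  shows "profile_tower r (case_nat g w) \<Longrightarrow> profile_tower r w"
    and "bounded_tower r (case_nat g w) \<Longrightarrow> bounded_tower r w"
proof -
  show "profile_tower r w" if W: "profile_tower r (case_nat g w)"
    unfolding profile_tower_def
  proof
    fix m
    show "\<forall>\<rho>\<in>{0<..<r}. (w m has_vector_derivative \<rho> *\<^sub>R w (Suc m) \<rho>) (at \<rho>)"
      using W[unfolded profile_tower_def, THEN spec, of "Suc m"] by simp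
  qed
  show "bounded_tower r w" if W: "bounded_tower r (case_nat g w)"
    unfolding bounded_tower_def
  proof
    fix m
    show "\<exists>B. \<forall>\<rho>\<in>{0<..<r}. norm (w m \<rho>) \<le> B"
      using W[unfolded bounded_tower_def, THEN spec, of "Suc m"] by simp
  qed
qed

text \<open>
  With \<open>g' = \<rho> f\<close> the corotational map with profile \<open>f\<close> is the gradient of the radial function
  \<open>g (norm x)\<close>. In this way its derivatives become derivatives of one radial function.
\<close>
lemma profile_tower_primitive:
  assumes w: "profile_tower r w" and "r > 0" and cont: "continuous_on {0..r} (w 0)"
  shows "\<exists>g. profile_tower r (case_nat g w) \<and> (\<exists>B. \<forall>\<rho>\<in>{0<..<r}. norm (g \<rho>) \<le> B)"
proof -
  have "continuous_on {0..r} (\<lambda>\<rho>. \<rho> *\<^sub>R w 0 \<rho>)" using cont by (intro continuous_intros)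
  then obtain g where g: "\<And>\<rho>. \<rho> \<in> {0..r} \<Longrightarrow> (g has_vector_derivative \<rho> *\<^sub>R w 0 \<rho>) (at \<rho> within {0..r})"
    using antiderivative_continuous by blast
  have "(g has_vector_derivative \<rho> *\<^sub>R w 0 \<rho>) (at \<rho>)" if "\<rho> \<in> {0<..<r}" for \<rho>
    using g[of \<rho>] that by (simp add: at_within_Icc_at)
  then have "profile_tower r (case_nat g w)"
    using w by (auto simp: profile_tower_def split: nat.split)
  moreover have "continuous_on {0..r} g"
    unfolding continuous_on_eq_continuous_within using g has_vector_derivative_continuous by blast
  then have "bounded (g ` {0..r})" by (intro compact_imp_bounded compact_continuous_image) auto
  then have "\<exists>B. \<forall>\<rho>\<in>{0<..<r}. norm (g \<rho>) \<le> B" by (fastforce simp: bounded_iff)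
  ultimately show ?thesis by blast
qed

lemma multi_deriv_bounded:
  assumes "u \<in> C_infinity_cball r"
  shows "\<exists>B. \<forall>x\<in>ball 0 r. norm (multi_deriv \<alpha> u x) \<le> B"
proof -
  have "\<exists>js. foldr (\<lambda>i. partial_deriv i ^^ \<alpha> i) is u = foldr partial_deriv js u" for "is"
  proof (induction "is")
    case (Cons i "is")
    then obtain js where "foldr (\<lambda>i. partial_deriv i ^^ \<alpha> i) is u = foldr partial_deriv js u" by blast
    then have "foldr (\<lambda>i. partial_deriv i ^^ \<alpha> i) (i # is) u
        = foldr partial_deriv (replicate (\<alpha> i) i @ js) u" by simp
    then show ?case by blast
  qed (auto intro: exI[of _ "[]"])
  then obtain js where js: "multi_deriv \<alpha> u = foldr partial_deriv js u"
    unfolding multi_deriv_def by blast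
  obtain g where g: "continuous_on (cball 0 r) g" "\<forall>x\<in>ball 0 r. g x = foldr partial_deriv js u x"
    using assms unfolding C_infinity_cball_def by blast
  have "bounded (g ` cball 0 r)"
    using g(1) by (intro compact_imp_bounded compact_continuous_image) auto
  then obtain B where "\<forall>x\<in>cball 0 r. norm (g x) \<le> B" by (auto simp: bounded_iff)
  then have "\<forall>x\<in>ball 0 r. norm (multi_deriv \<alpha> u x) \<le> B" using g(2) ball_subset_cball by (metis js subsetD)
  then show ?thesis by blast
qed

lemma multi_index_split:
  fixes \<alpha> :: "'n::finite \<Rightarrow> nat"
  assumes "(\<Sum>i\<in>UNIV. \<alpha> i) = Suc n"
  shows "\<exists>i \<beta>. \<alpha> = (\<lambda>j. (if j = i then 1 else 0) + \<beta> j) \<and> (\<Sum>i\<in>UNIV. \<beta> i) = n"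
proof -
  obtain i where i: "\<alpha> i > 0"
    using assms by (metis Zero_not_Suc not_gr_zero sum.neutral)
  define \<beta> where "\<beta> j = \<alpha> j - (if j = i then 1 else 0)" for j
  have eq: "\<alpha> = (\<lambda>j. (if j = i then 1 else 0) + \<beta> j)"
    using i by (auto simp: \<beta>_def)
  have "(\<Sum>j\<in>UNIV. \<alpha> j) = (\<Sum>j\<in>UNIV. if j = i then 1 else 0) + (\<Sum>j\<in>UNIV. \<beta> j)"
    by (subst eq) (rule sum.distrib)
  then have "(\<Sum>i\<in>UNIV. \<beta> i) = n" using assms by simp
  with eq show ?thesis by blast
qed

text \<open>
  The derivatives of the map are bounded since they extend continuously to the closed ball. The
  pointwise lower bound on the axis, at the even order \<open>2m\<close> where \<open>w\<^sub>m\<close> carries no weight, turns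
  this into boundedness of the profiles up to both ends of the interval. It guarantees the
  integrability of everything that follows and the vanishing boundary terms in
  the Hardy inequality. The condition \<open>m > 0\<close> leaves one differentiation to be spent on passing
  from the primitive to the components of the map.
\<close>
lemma corotational_tower_bounded:
  fixes F :: "real^'d::finite \<Rightarrow> complex^'d"
  assumes card: "CARD('d) \<ge> 2" and F: "F \<in> C_infinity_cball_map r"
    and W: "profile_tower r W" and "m > 0"
    and FW: "\<And>i x. x \<in> ball 0 r - {0} \<Longrightarrow> F x $ i = radial_deriv W (\<lambda>j. if j = i then 1 else 0) x"
  shows "\<exists>B. \<forall>\<rho>\<in>{0<..<r}. norm (W m \<rho>) \<le> B"
proof -
  obtain a b :: 'd where ab: "a \<noteq> b"
    using card by (metis card_2_iff' ex_card subset_UNIV)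
  obtain \<delta> C where \<delta>: "\<delta> > 0" "C > 0" and le: "\<And>w (x :: real^'d). x \<noteq> 0 \<Longrightarrow> norm (sgn x - axis a 1) < \<delta> \<Longrightarrow>
    level_energy w (2 * m) (norm x) \<le> C * (\<Sum>i\<in>orders (2 * m). (norm (radial_deriv w (two_axes_index a b (2 * m) i) x))\<^sup>2)"
    using level_energy_le_in_cone[OF ab, of "2 * m"] by blast
  have "\<exists>B. \<forall>x\<in>ball 0 r - {0}. norm (radial_deriv W (two_axes_index a b (2 * m) i) x) \<le> B"
    if i: "i \<in> orders (2 * m)" for i
  proof -
    obtain l \<beta> where \<beta>: "two_axes_index a b (2 * m) i = (\<lambda>j. (if j = l then 1 else 0) + \<beta> j)"
      using multi_index_split[of "two_axes_index a b (2 * m) i" "2 * m - 1"]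
        sum_two_axes_index[OF ab i] \<open>m > 0\<close> by auto
    obtain B where B: "\<forall>x\<in>ball 0 r. norm (multi_deriv \<beta> (\<lambda>x. F x $ l) x) \<le> B"
      using multi_deriv_bounded[of "\<lambda>x. F x $ l" r \<beta>] F by (auto simp: C_infinity_cball_map_def)
    have "radial_deriv W (two_axes_index a b (2 * m) i) x = multi_deriv \<beta> (\<lambda>x. F x $ l) x"
      if "x \<in> ball 0 r - {0}" for x
      using multi_deriv_radial[OF W, of "\<lambda>x. F x $ l" "\<lambda>j. if j = l then 1 else 0" x \<beta>] FW that
      unfolding \<beta> by metis
    then show ?thesis using B by (intro exI[of _ B]) auto
  qed
  then obtain B where B: "\<And>i x. i \<in> orders (2 * m) \<Longrightarrow> x \<in> ball 0 r - {0} \<Longrightarrow>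
      norm (radial_deriv W (two_axes_index a b (2 * m) i) x) \<le> B i" by metis
  have "norm (W m \<rho>) \<le> sqrt (C * (\<Sum>i\<in>orders (2 * m). (B i)\<^sup>2))" if \<rho>: "\<rho> \<in> {0<..<r}" for \<rho>
  proof -
    define x where "x = (\<rho> *\<^sub>R axis a 1 :: real^'d)"
    have x: "norm x = \<rho>" "x \<noteq> 0" "x \<in> ball 0 r - {0}" "sgn x = axis a 1"
      using \<rho> by (auto simp: x_def sgn_div_norm axis_eq_0_iff)
    have "(norm (W m \<rho>))\<^sup>2 = (\<rho> ^ (2 * m - 2 * m) * norm (W m \<rho>))\<^sup>2" by simp
    also have "\<dots> \<le> level_energy W (2 * m) \<rho>"
      unfolding level_energy_def
      by (rule member_le_sum[of m "orders (2 * m)" "\<lambda>l. (\<rho> ^ (2 * l - 2 * m) * norm (W l \<rho>))\<^sup>2"])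
        (auto simp: orders_def)
    also have "\<dots> \<le> C * (\<Sum>i\<in>orders (2 * m). (norm (radial_deriv W (two_axes_index a b (2 * m) i) x))\<^sup>2)"
      using le[of x W] x \<delta> by simp
    also have "\<dots> \<le> C * (\<Sum>i\<in>orders (2 * m). (B i)\<^sup>2)"
      using \<delta> B x by (intro mult_left_mono sum_mono power_mono) auto
    finally show ?thesis by (rule real_le_rsqrt)
  qed
  then show ?thesis by blast
qed

section \<open>Integrated comparison\<close>

definition energy_integral ::
  "real \<Rightarrow> nat \<Rightarrow> (nat \<Rightarrow> real \<Rightarrow> complex) \<Rightarrow> nat \<Rightarrow> real"
  where "energy_integral r p w n = (LINT \<rho>:{0<..<r}|lborel. \<rho> ^ p * level_energy w n \<rho>)"

lemma continuous_on_level_energy: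
  assumes "profile_tower r w"
  shows "continuous_on {0<..<r} (level_energy w n)"
  unfolding level_energy_def
  using profile_tower_continuous[OF assms] by (intro continuous_intros) auto

lemma level_energy_bounded:
  assumes "bounded_tower r w"
  shows "\<exists>B. \<forall>\<rho>\<in>{0<..<r}. level_energy w n \<rho> \<le> B"
proof -
  obtain B where B: "\<And>m \<rho>. \<rho> \<in> {0<..<r} \<Longrightarrow> norm (w m \<rho>) \<le> B m"
    using assms unfolding bounded_tower_def by metis
  have "level_energy w n \<rho> \<le> (\<Sum>m\<in>orders n. (r ^ (2 * m - n) * B m)\<^sup>2)" if \<rho>: "\<rho> \<in> {0<..<r}" for \<rho>
    unfolding level_energy_def
    using \<rho> B by (intro sum_mono power_mono mult_mono) auto
  then show ?thesis by blast
qed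

lemma continuous_on_radial_deriv:
  assumes "profile_tower r w"
  shows "continuous_on (ball 0 r - {0}) (radial_deriv w \<alpha>)"
proof -
  have "continuous_on (ball 0 r - {0}) (\<lambda>x. w m (norm x))" for m
    by (rule continuous_on_compose2[OF profile_tower_continuous[OF assms] continuous_on_norm_id]) auto
  then show ?thesis
    unfolding radial_deriv_def by (intro continuous_intros continuous_coeff_hermite_prod)
qed

lemma set_integrable_level_energy_norm:
  assumes "profile_tower r w" "bounded_tower r w"
  shows "set_integrable lborel (ball 0 r - {0}) (\<lambda>x :: real^'n::finite. level_energy w n (norm x))"
proof -
  obtain B where B: "\<forall>\<rho>\<in>{0<..<r}. level_energy w n \<rho> \<le> B"
    using level_energy_bounded[OF assms(2)] by blast
  show ?thesis
  proof (rule set_integrable_bounded_continuous[where B=B])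
    show "continuous_on (ball 0 r - {0}) (\<lambda>x :: real^'n. level_energy w n (norm x))"
      by (rule continuous_on_compose2[OF continuous_on_level_energy[OF assms(1)] continuous_on_norm_id]) auto
    show "\<bar>level_energy w n (norm x)\<bar> \<le> B" if "x \<in> ball 0 r - {0}" for x :: "real^'n"
      using B that level_energy_nonneg[of w n "norm x"] by auto
  qed (auto intro: bounded_subset[OF bounded_ball[of 0 r]])
qed

lemma set_integrable_radial_deriv:
  fixes \<alpha> :: "'n::finite \<Rightarrow> nat"
  assumes "profile_tower r w" "bounded_tower r w"
  shows "set_integrable lborel (ball 0 r - {0}) (\<lambda>x. (norm (radial_deriv w \<alpha> x))\<^sup>2)"
proof -
  obtain C where C: "C > 0" "\<And>x. x \<in> - {0} \<Longrightarrow>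
      (norm (radial_deriv w \<alpha> x))\<^sup>2 \<le> C * level_energy w (\<Sum>i\<in>UNIV. \<alpha> i) (norm x)"
    using radial_deriv_le_level_energy[OF refl, of \<alpha>] by blast
  obtain B where B: "\<forall>\<rho>\<in>{0<..<r}. level_energy w (\<Sum>i\<in>UNIV. \<alpha> i) \<rho> \<le> B"
    using level_energy_bounded[OF assms(2)] by blast
  show ?thesis
  proof (rule set_integrable_bounded_continuous[where B="C * B"])
    show "continuous_on (ball 0 r - {0}) (\<lambda>x. (norm (radial_deriv w \<alpha> x))\<^sup>2)"
      by (intro continuous_intros continuous_on_radial_deriv assms(1))
    show "\<bar>(norm (radial_deriv w \<alpha> x))\<^sup>2\<bar> \<le> C * B" if "x \<in> ball 0 r - {0}" for x
    proof -
      have "(norm (radial_deriv w \<alpha> x))\<^sup>2 \<le> C * level_energy w (\<Sum>i\<in>UNIV. \<alpha> i) (norm x)"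
        using C(2) that by simp
      also have "\<dots> \<le> C * B" using B C(1) that by (intro mult_left_mono) auto
      finally show ?thesis by simp
    qed
  qed (auto intro: bounded_subset[OF bounded_ball[of 0 r]])
qed

lemma integral_level_energy_norm:
  fixes K :: "(real^'n::finite) set"
  assumes "K \<in> sets borel" "dilation_invariant K" "r > 0" "profile_tower r w"
  shows "(LINT x:K \<inter> (ball 0 r - {0})|lborel. level_energy w n (norm x))
    = CARD('n) * measure lborel (K \<inter> cball 0 1) * energy_integral r (CARD('n) - 1) w n"
  unfolding energy_integral_def
  by (rule cone_polar_integral) (use assms continuous_on_level_energy in auto)

lemma energy_integral_nonneg: "energy_integral r p w n \<ge> 0"
  unfolding energy_integral_def set_lebesgue_integral_def
  by (intro Bochner_Integration.integral_nonneg)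
    (auto simp: level_energy_nonneg split: split_indicator)

lemma set_integral_nonneg_square: "(LINT x:S|M. (norm (h x))\<^sup>2) \<ge> 0"
  unfolding set_lebesgue_integral_def
  by (intro Bochner_Integration.integral_nonneg) (auto split: split_indicator)

lemma integral_radial_deriv_le_energy:
  fixes \<alpha> :: "'n::finite \<Rightarrow> nat"
  assumes "(\<Sum>i\<in>UNIV. \<alpha> i) = n" "r > 0"
  shows "\<exists>C>0. \<forall>w. profile_tower r w \<longrightarrow> bounded_tower r w \<longrightarrow>
    (LINT x:ball 0 r - {0}|lborel. (norm (radial_deriv w \<alpha> x))\<^sup>2) \<le> C * energy_integral r (CARD('n) - 1) w n"
proof -
  obtain C where C: "C > 0" "\<And>w x. x \<in> - {0} \<Longrightarrow>
      (norm (radial_deriv w \<alpha> x))\<^sup>2 \<le> C * level_energy w n (norm x)"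
    using radial_deriv_le_level_energy[OF assms(1)] by blast
  define \<kappa> where "\<kappa> = CARD('n) * measure lborel (cball (0 :: real^'n) 1)"
  have \<kappa>: "\<kappa> \<ge> 0" by (simp add: \<kappa>_def)
  have "(LINT x:ball 0 r - {0}|lborel. (norm (radial_deriv w \<alpha> x))\<^sup>2)
      \<le> (C * \<kappa> + 1) * energy_integral r (CARD('n) - 1) w n"
    if w: "profile_tower r w" "bounded_tower r w" for w
  proof -
    have "(LINT x:ball 0 r - {0}|lborel. (norm (radial_deriv w \<alpha> x))\<^sup>2)
        \<le> (LINT x:ball 0 r - {0}|lborel. C * level_energy w n (norm (x :: real^'n)))"
      using C(2) by (intro set_integral_mono set_integrable_radial_deriv set_integrable_mult_right
          set_integrable_level_energy_norm w) auto
    also have "\<dots> = C * (LINT x:UNIV \<inter> (ball 0 r - {0})|lborel. level_energy w n (norm (x :: real^'n)))"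
      by simp
    also have "\<dots> = C * (\<kappa> * energy_integral r (CARD('n) - 1) w n)"
      by (subst integral_level_energy_norm) (use assms w in \<open>auto simp: dilation_invariant_def \<kappa>_def\<close>)
    finally show ?thesis using energy_integral_nonneg[of r "CARD('n) - 1" w n] by (simp add: algebra_simps)
  qed
  moreover have "C * \<kappa> + 1 > 0" using C \<kappa> by (simp add: add_nonneg_pos)
  ultimately show ?thesis by blast
qed

text \<open>
  The pointwise lower bound holds only in a cone of directions. This is enough, because the level
  energy is radial: its integrals over the cone and over the ball differ by a constant factor,
  which is positive as the cone has interior points.
\<close>
lemma energy_le_integral_radial_deriv:
  fixes a b :: "'n::finite"
  assumes ab: "a \<noteq> b" and r: "r > 0"
  shows "\<exists>C>0. \<forall>w. profile_tower r w \<longrightarrow> bounded_tower r w \<longrightarrow>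
    energy_integral r (CARD('n) - 1) w n
      \<le> C * (\<Sum>i\<in>orders n. LINT x:ball 0 r - {0}|lborel. (norm (radial_deriv w (two_axes_index a b n i) x))\<^sup>2)"
proof -
  obtain \<delta> C where \<delta>: "\<delta> > 0" "C > 0" and le: "\<And>w (x :: real^'n). x \<noteq> 0 \<Longrightarrow> norm (sgn x - axis a 1) < \<delta> \<Longrightarrow>
    level_energy w n (norm x) \<le> C * (\<Sum>i\<in>orders n. (norm (radial_deriv w (two_axes_index a b n i) x))\<^sup>2)"
    using level_energy_le_in_cone[OF ab, of n] by blast
  define K where "K = {x :: real^'n. x \<noteq> 0 \<and> norm (sgn x - axis a 1) < \<delta>}"
  have "open K"
  proof -
    have "continuous_on (- {0 :: real^'n}) (\<lambda>x. norm (sgn x - axis a 1))"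
      unfolding sgn_div_norm by (intro continuous_intros) auto
    then have "open (- {0 :: real^'n} \<inter> (\<lambda>x. norm (sgn x - axis a 1)) -` {..<\<delta>})"
      by (rule continuous_open_preimage) auto
    also have "- {0 :: real^'n} \<inter> (\<lambda>x. norm (sgn x - axis a 1)) -` {..<\<delta>} = K"
      by (auto simp: K_def)
    finally show ?thesis .
  qed
  then have K: "K \<in> sets borel" by simp
  have dil: "dilation_invariant K"
    by (auto simp: dilation_invariant_def K_def sgn_scaleR)
  have K_pos: "measure lborel (K \<inter> cball 0 1) > 0"
  proof -
    define p where "p = ((1 / 2) *\<^sub>R axis a 1 :: real^'n)"
    have "p \<in> K \<inter> ball 0 1" using \<delta>(1) by (simp add: p_def K_def sgn_div_norm axis_eq_0_iff)
    then obtain e where e: "e > 0" "ball p e \<subseteq> K \<inter> ball 0 1"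
      using \<open>open K\<close> open_Int[OF \<open>open K\<close> open_ball] open_contains_ball by blast
    have "0 < measure lborel (ball p e)" using e(1) by (simp add: content_ball_pos)
    also have "\<dots> \<le> measure lborel (K \<inter> cball 0 1)"
      using e K finite_measure_bounded_Int[of K 1]
      by (intro measure_mono_fmeasurable) (auto simp: fmeasurable_def)
    finally show ?thesis .
  qed
  define \<kappa> where "\<kappa> = CARD('n) * measure lborel (K \<inter> cball 0 1)"
  have \<kappa>: "\<kappa> > 0" using K_pos by (simp add: \<kappa>_def)
  let ?D = "\<lambda>w i x. (norm (radial_deriv w (two_axes_index a b n i) x))\<^sup>2"
  have "energy_integral r (CARD('n) - 1) w n
      \<le> C / \<kappa> * (\<Sum>i\<in>orders n. LINT x:ball 0 r - {0}|lborel. ?D w i x)"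
    if w: "profile_tower r w" "bounded_tower r w" for w
  proof -
    note intD = set_integrable_radial_deriv[OF w]
    have intS: "set_integrable lborel (ball 0 r - {0}) (\<lambda>x. C * (\<Sum>i\<in>orders n. ?D w i x))"
      by (intro set_integrable_mult_right set_integrable_sum intD)
    have sets: "K \<inter> (ball 0 r - {0}) \<in> sets lborel" using K by auto
    have "\<kappa> * energy_integral r (CARD('n) - 1) w n
        = (LINT x:K \<inter> (ball 0 r - {0})|lborel. level_energy w n (norm x))"
      using integral_level_energy_norm[OF K dil r w(1)] by (simp add: \<kappa>_def)
    also have "\<dots> \<le> (LINT x:K \<inter> (ball 0 r - {0})|lborel. C * (\<Sum>i\<in>orders n. ?D w i x))"
      by (intro set_integral_mono set_integrable_subset[OF set_integrable_level_energy_norm[OF w]]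
          set_integrable_subset[OF intS] sets le) (auto simp: K_def)
    also have "\<dots> \<le> (LINT x:ball 0 r - {0}|lborel. C * (\<Sum>i\<in>orders n. ?D w i x))"
      unfolding set_lebesgue_integral_def
    proof (rule integral_mono)
      show "integrable lborel (\<lambda>x. indicator (K \<inter> (ball 0 r - {0})) x *\<^sub>R (C * (\<Sum>i\<in>orders n. ?D w i x)))"
        using set_integrable_subset[OF intS sets] by (simp add: set_integrable_def)
      show "integrable lborel (\<lambda>x. indicator (ball 0 r - {0}) x *\<^sub>R (C * (\<Sum>i\<in>orders n. ?D w i x)))"
        using intS by (simp add: set_integrable_def)
    qed (use \<delta> in \<open>auto simp: sum_nonneg split: split_indicator\<close>)
    also have "\<dots> = C * (\<Sum>i\<in>orders n. LINT x:ball 0 r - {0}|lborel. ?D w i x)"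
      by (simp add: set_integral_sum intD)
    finally show ?thesis using \<kappa> by (simp add: field_simps)
  qed
  moreover have "C / \<kappa> > 0" using \<delta> \<kappa> by simp
  ultimately show ?thesis by blast
qed

text \<open>
  The index family is arbitrary so that the lemma serves both sides of the comparison: all
  multi-indices of order at most \<open>k\<close> for the radial function, and for the corotational map the
  multi-indices increased by one in some component.
\<close>
lemma sum_integral_radial_deriv_equiv_energy:
  fixes idx :: "'i \<Rightarrow> 'n::finite \<Rightarrow> nat"
  assumes ab: "a \<noteq> b" and r: "r > 0" and fin: "finite I" "finite N"
    and sub: "\<And>\<iota>. \<iota> \<in> I \<Longrightarrow> (\<Sum>i\<in>UNIV. idx \<iota> i) \<in> N"
    and ex: "\<And>n i. n \<in> N \<Longrightarrow> i \<in> orders n \<Longrightarrow> \<exists>\<iota>\<in>I. idx \<iota> = two_axes_index a b n i"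
  shows "\<exists>c>0. \<exists>C>0. \<forall>w. profile_tower r w \<longrightarrow> bounded_tower r w \<longrightarrow>
    c * (\<Sum>n\<in>N. energy_integral r (CARD('n) - 1) w n)
      \<le> (\<Sum>\<iota>\<in>I. LINT x:ball 0 r - {0}|lborel. (norm (radial_deriv w (idx \<iota>) x))\<^sup>2) \<and>
    (\<Sum>\<iota>\<in>I. LINT x:ball 0 r - {0}|lborel. (norm (radial_deriv w (idx \<iota>) x))\<^sup>2)
      \<le> C * (\<Sum>n\<in>N. energy_integral r (CARD('n) - 1) w n)"
proof -
  let ?J = "\<lambda>w n. energy_integral r (CARD('n) - 1) w n"
  let ?D = "\<lambda>w \<alpha>. LINT x:ball 0 r - {0}|lborel. (norm (radial_deriv w (\<alpha> :: 'n \<Rightarrow> nat) x))\<^sup>2"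
  have D0: "?D w \<alpha> \<ge> 0" for w \<alpha> by (rule set_integral_nonneg_square)
  have "\<forall>\<iota>. \<exists>C>0. \<forall>w. profile_tower r w \<longrightarrow> bounded_tower r w \<longrightarrow>
      ?D w (idx \<iota>) \<le> C * ?J w (\<Sum>i\<in>UNIV. idx \<iota> i)"
    using integral_radial_deriv_le_energy[OF refl r] by blast
  then obtain C where C: "\<And>\<iota>. C \<iota> > 0" "\<And>\<iota> w. profile_tower r w \<Longrightarrow> bounded_tower r w \<Longrightarrow>
      ?D w (idx \<iota>) \<le> C \<iota> * ?J w (\<Sum>i\<in>UNIV. idx \<iota> i)" by metis
  have "\<forall>n. \<exists>C>0. \<forall>w. profile_tower r w \<longrightarrow> bounded_tower r w \<longrightarrow>
      ?J w n \<le> C * (\<Sum>i\<in>orders n. ?D w (two_axes_index a b n i))"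
    using energy_le_integral_radial_deriv[OF ab r] by blast
  then obtain C' where C': "\<And>n. C' n > 0" "\<And>n w. profile_tower r w \<Longrightarrow> bounded_tower r w \<Longrightarrow>
      ?J w n \<le> C' n * (\<Sum>i\<in>orders n. ?D w (two_axes_index a b n i))" by metis
  define A where "A = (\<Sum>\<iota>\<in>I. C \<iota>) + 1"
  define A' where "A' = (\<Sum>n\<in>N. C' n * card (orders n)) + 1"
  have A: "A > 0" unfolding A_def using C(1) by (intro add_nonneg_pos sum_nonneg) (auto intro: less_imp_le)
  have A': "A' > 0" unfolding A'_def using C'(1)
    by (intro add_nonneg_pos sum_nonneg mult_nonneg_nonneg) (auto intro: less_imp_le)
  have "(\<Sum>\<iota>\<in>I. ?D w (idx \<iota>)) \<le> A * (\<Sum>n\<in>N. ?J w n)"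
    and "(\<Sum>n\<in>N. ?J w n) \<le> A' * (\<Sum>\<iota>\<in>I. ?D w (idx \<iota>))"
    if w: "profile_tower r w" "bounded_tower r w" for w
  proof -
    have J0: "(\<Sum>n\<in>N. ?J w n) \<ge> 0" by (intro sum_nonneg energy_integral_nonneg)
    have S0: "(\<Sum>\<iota>\<in>I. ?D w (idx \<iota>)) \<ge> 0" by (intro sum_nonneg D0)
    have "(\<Sum>\<iota>\<in>I. ?D w (idx \<iota>)) \<le> (\<Sum>\<iota>\<in>I. C \<iota> * (\<Sum>n\<in>N. ?J w n))"
    proof (rule sum_mono)
      fix \<iota> assume \<iota>: "\<iota> \<in> I"
      have "?D w (idx \<iota>) \<le> C \<iota> * ?J w (\<Sum>i\<in>UNIV. idx \<iota> i)" using C(2)[OF w] .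
      also have "\<dots> \<le> C \<iota> * (\<Sum>n\<in>N. ?J w n)"
        using C(1)[of \<iota>] sub[OF \<iota>] fin by (intro mult_left_mono member_le_sum energy_integral_nonneg) auto
      finally show "?D w (idx \<iota>) \<le> C \<iota> * (\<Sum>n\<in>N. ?J w n)" .
    qed
    then show "(\<Sum>\<iota>\<in>I. ?D w (idx \<iota>)) \<le> A * (\<Sum>n\<in>N. ?J w n)"
      using J0 by (simp add: A_def sum_distrib_right distrib_right)
    have "(\<Sum>n\<in>N. ?J w n) \<le> (\<Sum>n\<in>N. C' n * card (orders n) * (\<Sum>\<iota>\<in>I. ?D w (idx \<iota>)))"
    proof (rule sum_mono)
      fix n assume n: "n \<in> N"
      have "?D w (two_axes_index a b n i) \<le> (\<Sum>\<iota>\<in>I. ?D w (idx \<iota>))" if i: "i \<in> orders n" for i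
      proof -
        obtain \<iota> where \<iota>: "\<iota> \<in> I" "idx \<iota> = two_axes_index a b n i" using ex[OF n i] by blast
        show ?thesis
          using member_le_sum[of \<iota> I "\<lambda>\<iota>. ?D w (idx \<iota>)"] \<iota> fin D0 by simp
      qed
      then have "(\<Sum>i\<in>orders n. ?D w (two_axes_index a b n i)) \<le> card (orders n) * (\<Sum>\<iota>\<in>I. ?D w (idx \<iota>))"
        using sum_bounded_above[of "orders n" "\<lambda>i. ?D w (two_axes_index a b n i)"] by simp
      then have "C' n * (\<Sum>i\<in>orders n. ?D w (two_axes_index a b n i))
          \<le> C' n * (card (orders n) * (\<Sum>\<iota>\<in>I. ?D w (idx \<iota>)))"
        using C'(1)[of n] by (intro mult_left_mono) auto
      then show "?J w n \<le> C' n * card (orders n) * (\<Sum>\<iota>\<in>I. ?D w (idx \<iota>))"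
        using C'(2)[OF w, of n] by (simp add: mult.assoc)
    qed
    then show "(\<Sum>n\<in>N. ?J w n) \<le> A' * (\<Sum>\<iota>\<in>I. ?D w (idx \<iota>))"
      using S0 by (simp add: A'_def sum_distrib_right distrib_right)
  qed
  then have "1 / A' * (\<Sum>n\<in>N. ?J w n) \<le> (\<Sum>\<iota>\<in>I. ?D w (idx \<iota>)) \<and>
      (\<Sum>\<iota>\<in>I. ?D w (idx \<iota>)) \<le> A * (\<Sum>n\<in>N. ?J w n)"
    if "profile_tower r w" "bounded_tower r w" for w
    using that A' by (simp add: field_simps)
  moreover have "1 / A' > 0" using A' by simp
  ultimately show ?thesis using A by blast
qed

section \<open>Comparison of the Sobolev norms\<close>

text \<open>Removing the origin changes the integrand at a single point only.\<close>
lemma L2_norm_multi_deriv_radial: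
  fixes u :: "real^'n::finite \<Rightarrow> complex"
  assumes w: "profile_tower r w"
    and u: "\<And>x. x \<in> ball 0 r - {0} \<Longrightarrow> u x = radial_deriv w \<beta> x"
  shows "(L2_norm_ball r (multi_deriv \<alpha> u))\<^sup>2
    = (LINT x:ball 0 r - {0}|lborel. (norm (radial_deriv w (\<lambda>j. \<beta> j + \<alpha> j) x))\<^sup>2)"
proof -
  have "(L2_norm_ball r (multi_deriv \<alpha> u))\<^sup>2 = (LINT x:ball 0 r|lborel. (norm (multi_deriv \<alpha> u x))\<^sup>2)"
    unfolding L2_norm_ball_def by (rule real_sqrt_pow2) (rule set_integral_nonneg_square)
  also have "\<dots> = (LINT x:ball 0 r - {0}|lborel. (norm (radial_deriv w (\<lambda>j. \<beta> j + \<alpha> j) x))\<^sup>2)"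
    unfolding set_lebesgue_integral_def
    by (rule integral_discrete_difference[where X="{0}"])
      (use multi_deriv_radial[OF w u] in \<open>auto split: split_indicator\<close>)
  finally show ?thesis .
qed

lemma sobolev_norm_map_radial:
  assumes W: "profile_tower r W"
    and FW: "\<And>i x. x \<in> ball 0 r - {0} \<Longrightarrow> F x $ i = radial_deriv W (\<lambda>j. if j = i then 1 else 0) x"
  shows "(sobolev_norm_map k r (F :: real^'n::finite \<Rightarrow> complex^'n))\<^sup>2
    = (\<Sum>(i, \<alpha>)\<in>UNIV \<times> multi_indices k. LINT x:ball 0 r - {0}|lborel.
        (norm (radial_deriv W (\<lambda>j. (if j = i then 1 else 0) + \<alpha> j) (x :: real^'n)))\<^sup>2)"
proof -
  have "(sobolev_norm_map k r F)\<^sup>2 = (\<Sum>i\<in>UNIV. (sobolev_norm k r (\<lambda>x. F x $ i))\<^sup>2)"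
    unfolding sobolev_norm_map_def by (rule real_sqrt_pow2) (simp add: sum_nonneg)
  also have "\<dots> = (\<Sum>i\<in>UNIV. \<Sum>\<alpha>\<in>multi_indices k. (L2_norm_ball r (multi_deriv \<alpha> (\<lambda>x. F x $ i)))\<^sup>2)"
    unfolding sobolev_norm_def by (intro sum.cong refl real_sqrt_pow2 sum_nonneg) simp
  also have "\<dots> = (\<Sum>(i, \<alpha>)\<in>UNIV \<times> multi_indices k. (L2_norm_ball r (multi_deriv \<alpha> (\<lambda>x. F x $ i)))\<^sup>2)"
    by (rule sum.cartesian_product)
  also have "\<dots> = (\<Sum>(i, \<alpha>)\<in>UNIV \<times> multi_indices k. LINT x:ball 0 r - {0}|lborel.
        (norm (radial_deriv W (\<lambda>j. (if j = i then 1 else 0) + \<alpha> j) (x :: real^'n)))\<^sup>2)"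
    by (intro sum.cong refl) (auto intro!: L2_norm_multi_deriv_radial[OF W FW])
  finally show ?thesis .
qed

lemma sobolev_norm_radial:
  assumes w: "profile_tower r w"
  shows "(sobolev_norm k r (\<lambda>y :: real^'n::finite. w 0 (norm y)))\<^sup>2
    = (\<Sum>\<alpha>\<in>multi_indices k. LINT x:ball 0 r - {0}|lborel. (norm (radial_deriv w (\<alpha> :: 'n \<Rightarrow> nat) x))\<^sup>2)"
proof -
  have "(sobolev_norm k r (\<lambda>y :: real^'n. w 0 (norm y)))\<^sup>2
      = (\<Sum>\<alpha>\<in>multi_indices k. (L2_norm_ball r (multi_deriv \<alpha> (\<lambda>y :: real^'n. w 0 (norm y))))\<^sup>2)"
    unfolding sobolev_norm_def by (intro real_sqrt_pow2 sum_nonneg) simp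
  also have "\<dots> = (\<Sum>\<alpha>\<in>multi_indices k. LINT x:ball 0 r - {0}|lborel. (norm (radial_deriv w (\<alpha> :: 'n \<Rightarrow> nat) x))\<^sup>2)"
    by (intro sum.cong refl)
      (subst L2_norm_multi_deriv_radial[OF w, where \<beta>="\<lambda>_. 0"], simp_all add: radial_deriv_zero)
  finally show ?thesis .
qed

definition profile_moment :: "real \<Rightarrow> (nat \<Rightarrow> real \<Rightarrow> complex) \<Rightarrow> nat \<Rightarrow> nat \<Rightarrow> real"
  where "profile_moment r w q m = (LINT \<rho>:{0<..<r}|lborel. \<rho> ^ q * (norm (w m \<rho>))\<^sup>2)"

lemma set_integrable_profile_moment:
  assumes "profile_tower r w" "bounded_tower r w"
  shows "set_integrable lborel {0<..<r} (\<lambda>\<rho>. \<rho> ^ q * (norm (w m \<rho>))\<^sup>2)"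
proof -
  obtain B where B: "\<And>\<rho>. \<rho> \<in> {0<..<r} \<Longrightarrow> norm (w m \<rho>) \<le> B"
    using assms(2) unfolding bounded_tower_def by blast
  show ?thesis
  proof (rule set_integrable_bounded_continuous[where B="r ^ q * B\<^sup>2"])
    fix \<rho> assume \<rho>: "\<rho> \<in> {0<..<r}"
    have "\<rho> ^ q \<le> r ^ q" using \<rho> by (intro power_mono) auto
    moreover have "(norm (w m \<rho>))\<^sup>2 \<le> B\<^sup>2" using B[OF \<rho>] by (intro power_mono) auto
    ultimately show "\<bar>\<rho> ^ q * (norm (w m \<rho>))\<^sup>2\<bar> \<le> r ^ q * B\<^sup>2"
      using \<rho> by (simp add: abs_mult mult_mono)
  qed (auto intro!: continuous_intros profile_tower_continuous[OF assms(1)])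
qed

lemma profile_moment_nonneg: "profile_moment r w q m \<ge> 0"
  unfolding profile_moment_def set_lebesgue_integral_def
  by (intro Bochner_Integration.integral_nonneg) (auto split: split_indicator)

lemma energy_integral_eq_moments:
  assumes "profile_tower r w" "bounded_tower r w"
  shows "energy_integral r p w n = (\<Sum>m\<in>orders n. profile_moment r w (p + 2 * (2 * m - n)) m)"
proof -
  have "energy_integral r p w n
      = (LINT \<rho>:{0<..<r}|lborel. \<Sum>m\<in>orders n. \<rho> ^ (p + 2 * (2 * m - n)) * (norm (w m \<rho>))\<^sup>2)"
    unfolding energy_integral_def level_energy_def
    by (simp add: sum_distrib_left power_mult_distrib power_add power_mult[symmetric] mult_ac)
  also have "\<dots> = (\<Sum>m\<in>orders n. profile_moment r w (p + 2 * (2 * m - n)) m)"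
    unfolding profile_moment_def by (intro set_integral_sum set_integrable_profile_moment assms)
  finally show ?thesis .
qed

lemma orders_Suc:
  "orders (Suc n) = Suc ` (orders n \<union> (if odd n then {n div 2} else {}))"
proof (intro equalityI subsetI)
  fix m assume m: "m \<in> orders (Suc n)"
  then obtain l where l: "m = Suc l" by (cases m) (auto simp: orders_def)
  then have "n \<le> 2 * l + 1" "l \<le> n" using m by (auto simp: orders_def)
  then have "l \<in> orders n \<union> (if odd n then {n div 2} else {})"
    by (auto simp: orders_def)
  then show "m \<in> Suc ` (orders n \<union> (if odd n then {n div 2} else {}))" using l by blast
next
  fix m assume "m \<in> Suc ` (orders n \<union> (if odd n then {n div 2} else {}))"
  then show "m \<in> orders (Suc n)" by (auto simp: orders_def split: if_splits)
qed

text \<open>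
  The entries of level \<open>n + 1\<close> for the primitive have the same total powers of \<open>\<rho>\<close> in dimension \<open>d\<close>
  (weight \<open>\<rho>\<^sup>p\<close> with \<open>p = d - 1\<close>) as those of level \<open>n\<close> for the profile itself in dimension
  \<open>d + 2\<close>. The only entry without a counterpart is the lowest one, present for odd \<open>n\<close>.
\<close>
lemma energy_integral_primitive:
  assumes W: "profile_tower r (case_nat g w)" "bounded_tower r (case_nat g w)"
    and w: "profile_tower r w" "bounded_tower r w"
  shows "energy_integral r p (case_nat g w) (Suc n)
    = energy_integral r (p + 2) w n + (if odd n then profile_moment r w p (n div 2) else 0)"
proof -
  define X where "X = (if odd n then {n div 2} else {})"
  have fin: "finite X" by (simp add: X_def)
  have disj: "orders n \<inter> X = {}" unfolding X_def orders_def by (auto elim: oddE)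
  have "energy_integral r p (case_nat g w) (Suc n)
      = (\<Sum>l\<in>orders n \<union> X. profile_moment r (case_nat g w) (p + 2 * (2 * Suc l - Suc n)) (Suc l))"
    unfolding energy_integral_eq_moments[OF W] orders_Suc X_def
    by (subst sum.reindex) auto
  also have "\<dots> = (\<Sum>l\<in>orders n \<union> X. profile_moment r w (p + 2 * (2 * l + 1 - n)) l)"
    by (intro sum.cong refl) (simp add: profile_moment_def)
  also have "\<dots> = (\<Sum>l\<in>orders n. profile_moment r w (p + 2 * (2 * l + 1 - n)) l)
      + (\<Sum>l\<in>X. profile_moment r w (p + 2 * (2 * l + 1 - n)) l)"
    using fin disj by (intro sum.union_disjoint) auto
  also have "(\<Sum>l\<in>orders n. profile_moment r w (p + 2 * (2 * l + 1 - n)) l) = energy_integral r (p + 2) w n"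
    unfolding energy_integral_eq_moments[OF w]
  proof (intro sum.cong refl)
    fix l assume "l \<in> orders n"
    then have "p + 2 * (2 * l + 1 - n) = p + 2 + 2 * (2 * l - n)" by (auto simp: orders_def)
    then show "profile_moment r w (p + 2 * (2 * l + 1 - n)) l = profile_moment r w (p + 2 + 2 * (2 * l - n)) l"
      by (rule arg_cong)
  qed
  also have "(\<Sum>l\<in>X. profile_moment r w (p + 2 * (2 * l + 1 - n)) l)
      = (if odd n then profile_moment r w p (n div 2) else 0)"
    unfolding X_def by (auto elim: oddE)
  finally show ?thesis .
qed

text \<open>
  The entry without a counterpart is controlled by the Hardy inequality, since the derivative of
  \<open>w m\<close> is \<open>\<rho>\<close> times the next profile.
\<close>
lemma profile_moment_hardy:
  assumes d: "d \<ge> 1" and r: "r > 0"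
  shows "\<exists>A>0. \<forall>w m. profile_tower r w \<longrightarrow> bounded_tower r w \<longrightarrow>
    profile_moment r w (d - 1) m
      \<le> A * (energy_integral r (d + 1) w (2 * m) + energy_integral r (d + 1) w (2 * m + 1))"
proof -
  define A1 where "A1 = 2 * (real d + 1)\<^sup>2 / (real d * r)\<^sup>2"
  define A2 where "A2 = 8 / (real d)\<^sup>2"
  have A: "A1 > 0" "A2 > 0" using d r by (auto simp: A1_def A2_def intro!: divide_pos_pos)
  have "profile_moment r w (d - 1) m
      \<le> (A1 + A2) * (energy_integral r (d + 1) w (2 * m) + energy_integral r (d + 1) w (2 * m + 1))"
    if w: "profile_tower r w" "bounded_tower r w" for w m
  proof -
    obtain B0 B1 where B: "\<And>\<rho>. \<rho> \<in> {0<..<r} \<Longrightarrow> norm (w m \<rho>) \<le> B0"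
      "\<And>\<rho>. \<rho> \<in> {0<..<r} \<Longrightarrow> norm (w (Suc m) \<rho>) \<le> B1"
      using w(2) unfolding bounded_tower_def by meson
    have "(LINT \<rho>:{0<..<r}|lborel. \<rho> ^ (d - 1) * (norm (w m \<rho>))\<^sup>2)
      \<le> A1 * (LINT \<rho>:{0<..<r}|lborel. \<rho> ^ (d + 1) * (norm (w m \<rho>))\<^sup>2)
      + A2 * (LINT \<rho>:{0<..<r}|lborel. \<rho> ^ (d + 1) * (norm (\<rho> *\<^sub>R w (Suc m) \<rho>))\<^sup>2)"
      unfolding A1_def A2_def
    proof (rule hardy_inequality[where B="max B0 (r * B1)"])
      fix \<rho> assume \<rho>: "\<rho> \<in> {0<..<r}"
      show "(w m has_vector_derivative \<rho> *\<^sub>R w (Suc m) \<rho>) (at \<rho>)"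
        using w(1) \<rho> by (simp add: profile_tower_def)
      show "norm (w m \<rho>) \<le> max B0 (r * B1)" using B(1)[OF \<rho>] by simp
      have "norm (\<rho> *\<^sub>R w (Suc m) \<rho>) \<le> r * B1"
        using \<rho> B(2)[OF \<rho>] by (auto intro!: mult_mono)
      then show "norm (\<rho> *\<^sub>R w (Suc m) \<rho>) \<le> max B0 (r * B1)" by simp
    qed (use d r in \<open>auto intro!: continuous_intros profile_tower_continuous[OF w(1)]\<close>)
    also have "(LINT \<rho>:{0<..<r}|lborel. \<rho> ^ (d + 1) * (norm (\<rho> *\<^sub>R w (Suc m) \<rho>))\<^sup>2)
        = profile_moment r w (d + 3) (Suc m)"
      unfolding profile_moment_def set_lebesgue_integral_def
      by (intro Bochner_Integration.integral_cong refl)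
        (auto simp: power_mult_distrib power_add power2_eq_square power3_eq_cube split: split_indicator)
    finally have "profile_moment r w (d - 1) m
        \<le> A1 * profile_moment r w (d + 1) m + A2 * profile_moment r w (d + 3) (Suc m)"
      by (simp add: profile_moment_def)
    moreover have "profile_moment r w (d + 1) m \<le> energy_integral r (d + 1) w (2 * m)"
      unfolding energy_integral_eq_moments[OF w]
      using member_le_sum[of m "orders (2 * m)" "\<lambda>l. profile_moment r w (d + 1 + 2 * (2 * l - 2 * m)) l"]
      by (simp add: profile_moment_nonneg orders_def)
    moreover have "profile_moment r w (d + 3) (Suc m) \<le> energy_integral r (d + 1) w (2 * m + 1)"
    proof -
      have "d + 3 = d + 1 + 2 * (2 * Suc m - (2 * m + 1))" by simp
      moreover have "profile_moment r w (d + 1 + 2 * (2 * Suc m - (2 * m + 1))) (Suc m)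
          \<le> energy_integral r (d + 1) w (2 * m + 1)"
        unfolding energy_integral_eq_moments[OF w]
        by (rule member_le_sum[of "Suc m" "orders (2 * m + 1)" "\<lambda>l. profile_moment r w (d + 1 + 2 * (2 * l - (2 * m + 1))) l"])
          (auto simp: profile_moment_nonneg orders_def)
      ultimately show ?thesis by (simp only:)
    qed
    ultimately have "profile_moment r w (d - 1) m
        \<le> A1 * energy_integral r (d + 1) w (2 * m) + A2 * energy_integral r (d + 1) w (2 * m + 1)"
      using A by (meson add_mono mult_left_mono less_imp_le order_trans)
    also have "\<dots> \<le> (A1 + A2) * energy_integral r (d + 1) w (2 * m)
        + (A1 + A2) * energy_integral r (d + 1) w (2 * m + 1)"
      using A by (intro add_mono mult_right_mono energy_integral_nonneg) auto
    finally show ?thesis by (simp add: distrib_left)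
  qed
  then show ?thesis using A by (intro exI[of _ "A1 + A2"]) auto
qed

lemma energy_sums_equiv:
  assumes d: "d \<ge> 1" and r: "r > 0"
  shows "\<exists>A>0. \<forall>g w. profile_tower r (case_nat g w) \<longrightarrow> bounded_tower r (case_nat g w) \<longrightarrow>
    (\<Sum>n\<le>k. energy_integral r (d + 1) w n) \<le> (\<Sum>n\<in>{1..Suc k}. energy_integral r (d - 1) (case_nat g w) n) \<and>
    (\<Sum>n\<in>{1..Suc k}. energy_integral r (d - 1) (case_nat g w) n) \<le> A * (\<Sum>n\<le>k. energy_integral r (d + 1) w n)"
proof -
  obtain A where A: "A > 0" "\<And>w m. profile_tower r w \<Longrightarrow> bounded_tower r w \<Longrightarrow>
    profile_moment r w (d - 1) m
      \<le> A * (energy_integral r (d + 1) w (2 * m) + energy_integral r (d + 1) w (2 * m + 1))"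
    using profile_moment_hardy[OF d r] by blast
  have "(\<Sum>n\<le>k. energy_integral r (d + 1) w n) \<le> (\<Sum>n\<in>{1..Suc k}. energy_integral r (d - 1) (case_nat g w) n)"
    and "(\<Sum>n\<in>{1..Suc k}. energy_integral r (d - 1) (case_nat g w) n)
      \<le> (1 + real (Suc k) * (2 * A)) * (\<Sum>n\<le>k. energy_integral r (d + 1) w n)"
    if W: "profile_tower r (case_nat g w)" "bounded_tower r (case_nat g w)" for g w
  proof -
    have w: "profile_tower r w" "bounded_tower r w"
      using W by (auto dest: tower_tail)
    define E where "E = (\<Sum>n\<le>k. energy_integral r (d + 1) w n)"
    define X where "X n = (if odd n then profile_moment r w (d - 1) (n div 2) else 0)" for n
    have E_ge: "energy_integral r (d + 1) w n \<le> E" if "n \<le> k" for n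
      unfolding E_def using that by (intro member_le_sum energy_integral_nonneg) auto
    have E0: "E \<ge> 0" unfolding E_def by (intro sum_nonneg energy_integral_nonneg)
    have "(\<Sum>n\<in>{1..Suc k}. energy_integral r (d - 1) (case_nat g w) n)
        = (\<Sum>n\<le>k. energy_integral r (d - 1) (case_nat g w) (Suc n))"
      using sum.shift_bounds_cl_Suc_ivl[of "energy_integral r (d - 1) (case_nat g w)" 0 k]
      by (simp add: atMost_atLeast0)
    also have "\<dots> = (\<Sum>n\<le>k. energy_integral r (d + 1) w n + X n)"
      using d by (intro sum.cong refl) (simp add: energy_integral_primitive[OF W w] X_def)
    also have "\<dots> = E + (\<Sum>n\<le>k. X n)" by (simp add: E_def sum.distrib)
    finally have eq: "(\<Sum>n\<in>{1..Suc k}. energy_integral r (d - 1) (case_nat g w) n) = E + (\<Sum>n\<le>k. X n)" .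
    have "X n \<ge> 0" for n by (simp add: X_def profile_moment_nonneg)
    then show "(\<Sum>n\<le>k. energy_integral r (d + 1) w n) \<le> (\<Sum>n\<in>{1..Suc k}. energy_integral r (d - 1) (case_nat g w) n)"
      unfolding eq E_def[symmetric] by (simp add: sum_nonneg)
    have "X n \<le> 2 * A * E" if n: "n \<le> k" for n
    proof (cases "odd n")
      case True
      then have n2: "n = 2 * (n div 2) + 1" by presburger
      have "X n \<le> A * (energy_integral r (d + 1) w (2 * (n div 2)) + energy_integral r (d + 1) w (2 * (n div 2) + 1))"
        unfolding X_def if_P[OF True] by (rule A(2)[OF w])
      also have "\<dots> \<le> A * (E + E)"
        using A(1) n n2 by (intro mult_left_mono add_mono E_ge) auto
      finally show ?thesis by simp
    next
      case False
      then show ?thesis using A(1) E0 by (simp add: X_def)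
    qed
    then have "(\<Sum>n\<le>k. X n) \<le> real (Suc k) * (2 * A * E)"
      using sum_bounded_above[of "{..k}" X "2 * A * E"] by simp
    then show "(\<Sum>n\<in>{1..Suc k}. energy_integral r (d - 1) (case_nat g w) n)
        \<le> (1 + real (Suc k) * (2 * A)) * (\<Sum>n\<le>k. energy_integral r (d + 1) w n)"
      unfolding eq E_def[symmetric] by (simp add: algebra_simps)
  qed
  moreover have "1 + real (Suc k) * (2 * A) > 0" using A(1) by (simp add: add_pos_nonneg)
  ultimately show ?thesis by blast
qed

lemma sobolev_norm_equiv_energy:
  assumes "CARD('n::finite) \<ge> 2" "r > 0"
  shows "\<exists>c>0. \<exists>C>0. \<forall>w. profile_tower r w \<longrightarrow> bounded_tower r w \<longrightarrow>
    c * (\<Sum>n\<le>k. energy_integral r (CARD('n) - 1) w n) \<le> (sobolev_norm k r (\<lambda>y :: real^'n. w 0 (norm y)))\<^sup>2 \<and>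
    (sobolev_norm k r (\<lambda>y :: real^'n. w 0 (norm y)))\<^sup>2 \<le> C * (\<Sum>n\<le>k. energy_integral r (CARD('n) - 1) w n)"
proof -
  obtain a b :: 'n where ab: "a \<noteq> b"
    using assms(1) by (metis card_2_iff' ex_card subset_UNIV)
  have "\<exists>c>0. \<exists>C>0. \<forall>w. profile_tower r w \<longrightarrow> bounded_tower r w \<longrightarrow>
    c * (\<Sum>n\<le>k. energy_integral r (CARD('n) - 1) w n)
      \<le> (\<Sum>\<alpha>\<in>multi_indices k. LINT x:ball 0 r - {0}|lborel. (norm (radial_deriv w (\<alpha> :: 'n \<Rightarrow> nat) x))\<^sup>2) \<and>
    (\<Sum>\<alpha>\<in>multi_indices k. LINT x:ball 0 r - {0}|lborel. (norm (radial_deriv w (\<alpha> :: 'n \<Rightarrow> nat) x))\<^sup>2)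
      \<le> C * (\<Sum>n\<le>k. energy_integral r (CARD('n) - 1) w n)"
    by (rule sum_integral_radial_deriv_equiv_energy[OF ab assms(2) finite_multi_indices])
      (auto simp: multi_indices_def sum_two_axes_index[OF ab])
  then show ?thesis by (simp add: sobolev_norm_radial)
qed

lemma sobolev_norm_map_equiv_energy:
  assumes "CARD('n::finite) \<ge> 2" "r > 0"
  shows "\<exists>c>0. \<exists>C>0. \<forall>W (F :: real^'n \<Rightarrow> complex^'n). profile_tower r W \<longrightarrow> bounded_tower r W \<longrightarrow>
    (\<forall>i. \<forall>x\<in>ball 0 r - {0}. F x $ i = radial_deriv W (\<lambda>j. if j = i then 1 else 0) x) \<longrightarrow>
    c * (\<Sum>n\<in>{1..Suc k}. energy_integral r (CARD('n) - 1) W n) \<le> (sobolev_norm_map k r F)\<^sup>2 \<and>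
    (sobolev_norm_map k r F)\<^sup>2 \<le> C * (\<Sum>n\<in>{1..Suc k}. energy_integral r (CARD('n) - 1) W n)"
proof -
  obtain a b :: 'n where ab: "a \<noteq> b"
    using assms(1) by (metis card_2_iff' ex_card subset_UNIV)
  define idx where "idx = (\<lambda>(i :: 'n, \<alpha>). \<lambda>j. (if j = i then 1 else 0 :: nat) + \<alpha> j)"
  have sum_idx: "(\<Sum>j\<in>UNIV. idx (i, \<alpha>) j) = Suc (\<Sum>j\<in>UNIV. \<alpha> j)" for i \<alpha>
    by (simp add: idx_def sum.distrib)
  have "\<exists>c>0. \<exists>C>0. \<forall>W. profile_tower r W \<longrightarrow> bounded_tower r W \<longrightarrow>
    c * (\<Sum>n\<in>{1..Suc k}. energy_integral r (CARD('n) - 1) W n)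
      \<le> (\<Sum>\<iota>\<in>UNIV \<times> multi_indices k. LINT x:ball 0 r - {0}|lborel. (norm (radial_deriv W (idx \<iota>) x))\<^sup>2) \<and>
    (\<Sum>\<iota>\<in>UNIV \<times> multi_indices k. LINT x:ball 0 r - {0}|lborel. (norm (radial_deriv W (idx \<iota>) x))\<^sup>2)
      \<le> C * (\<Sum>n\<in>{1..Suc k}. energy_integral r (CARD('n) - 1) W n)"
  proof (rule sum_integral_radial_deriv_equiv_energy[OF ab assms(2)])
    fix \<iota> :: "'n \<times> ('n \<Rightarrow> nat)" assume "\<iota> \<in> UNIV \<times> multi_indices k"
    then show "(\<Sum>i\<in>UNIV. idx \<iota> i) \<in> {1..Suc k}"
      by (cases \<iota>) (auto simp: sum_idx multi_indices_def)
  next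
    fix n i assume n: "n \<in> {1..Suc k}" and i: "i \<in> orders n"
    obtain l \<beta> where "two_axes_index a b n i = (\<lambda>j. (if j = l then 1 else 0) + \<beta> j)"
        "(\<Sum>j\<in>UNIV. \<beta> j) = n - 1"
      using multi_index_split[of "two_axes_index a b n i" "n - 1"] sum_two_axes_index[OF ab i] n by auto
    then show "\<exists>\<iota>\<in>UNIV \<times> multi_indices k. idx \<iota> = two_axes_index a b n i"
      using n by (intro bexI[of _ "(l, \<beta>)"]) (auto simp: idx_def multi_indices_def)
  qed (auto intro: finite_multi_indices)
  moreover have "(\<Sum>\<iota>\<in>UNIV \<times> multi_indices k. LINT x:ball 0 r - {0}|lborel. (norm (radial_deriv W (idx \<iota>) x))\<^sup>2)
      = (sobolev_norm_map k r F)\<^sup>2"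
    if "profile_tower r W" "\<forall>i. \<forall>x\<in>ball 0 r - {0}. F x $ i = radial_deriv W (\<lambda>j. if j = i then 1 else 0) x"
    for W and F :: "real^'n \<Rightarrow> complex^'n"
    by (subst sobolev_norm_map_radial[OF that(1)]) (use that(2) in \<open>auto simp: idx_def intro!: sum.cong\<close>)
  ultimately show ?thesis by metis
qed

theorem theorem1p3:
  fixes k :: nat and r :: real
  assumes "CARD('d::finite) \<ge> 2"
    and "CARD('e::finite) = CARD('d) + 2"
    and "r > 0"
  shows "\<exists>c>0. \<exists>C>0. \<forall>(F :: real^'d \<Rightarrow> complex^'d) (f :: real \<Rightarrow> complex).
    F \<in> C_infinity_cball_map r \<longrightarrow> f \<in> C_infinity_ev r \<longrightarrow> corotational_with_profile r F f \<longrightarrow>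
      c * sobolev_norm k r (\<lambda>y::real^'e. f (norm y)) \<le> sobolev_norm_map k r F \<and>
      sobolev_norm_map k r F \<le> C * sobolev_norm k r (\<lambda>y::real^'e. f (norm y))"
proof -
  have r: "r > 0" and e: "CARD('e) \<ge> 2" and d: "CARD('d) \<ge> 1" using assms by auto
  obtain c1 C1 where 1: "c1 > 0" "C1 > 0" "\<And>w. profile_tower r w \<Longrightarrow> bounded_tower r w \<Longrightarrow>
    c1 * (\<Sum>n\<le>k. energy_integral r (CARD('e) - 1) w n) \<le> (sobolev_norm k r (\<lambda>y :: real^'e. w 0 (norm y)))\<^sup>2 \<and>
    (sobolev_norm k r (\<lambda>y :: real^'e. w 0 (norm y)))\<^sup>2 \<le> C1 * (\<Sum>n\<le>k. energy_integral r (CARD('e) - 1) w n)"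
    using sobolev_norm_equiv_energy[OF e r, of k] by blast
  obtain c2 C2 where 2: "c2 > 0" "C2 > 0" "\<And>W (F :: real^'d \<Rightarrow> complex^'d). profile_tower r W \<Longrightarrow> bounded_tower r W \<Longrightarrow>
    (\<forall>i. \<forall>x\<in>ball 0 r - {0}. F x $ i = radial_deriv W (\<lambda>j. if j = i then 1 else 0) x) \<Longrightarrow>
    c2 * (\<Sum>n\<in>{1..Suc k}. energy_integral r (CARD('d) - 1) W n) \<le> (sobolev_norm_map k r F)\<^sup>2 \<and>
    (sobolev_norm_map k r F)\<^sup>2 \<le> C2 * (\<Sum>n\<in>{1..Suc k}. energy_integral r (CARD('d) - 1) W n)"
    using sobolev_norm_map_equiv_energy[OF assms(1) r, of k] by blast
  obtain A where A: "A > 0" "\<And>g w. profile_tower r (case_nat g w) \<Longrightarrow> bounded_tower r (case_nat g w) \<Longrightarrow>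
    (\<Sum>n\<le>k. energy_integral r (CARD('d) + 1) w n) \<le> (\<Sum>n\<in>{1..Suc k}. energy_integral r (CARD('d) - 1) (case_nat g w) n) \<and>
    (\<Sum>n\<in>{1..Suc k}. energy_integral r (CARD('d) - 1) (case_nat g w) n) \<le> A * (\<Sum>n\<le>k. energy_integral r (CARD('d) + 1) w n)"
    using energy_sums_equiv[OF d r, of k] by blast
  have e_eq: "CARD('e) - 1 = CARD('d) + 1" using assms(2) by simp
  have sq: "c2 / C1 * (sobolev_norm k r (\<lambda>y::real^'e. f (norm y)))\<^sup>2 \<le> (sobolev_norm_map k r F)\<^sup>2 \<and>
      (sobolev_norm_map k r F)\<^sup>2 \<le> C2 * A / c1 * (sobolev_norm k r (\<lambda>y::real^'e. f (norm y)))\<^sup>2"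
    if F: "F \<in> C_infinity_cball_map r" and f: "f \<in> C_infinity_ev r" and cor: "corotational_with_profile r F f"
    for F :: "real^'d \<Rightarrow> complex^'d" and f
  proof -
    have fI: "f \<in> C_infinity_Icc r" using f by (simp add: C_infinity_ev_def)
    obtain w where w: "profile_tower r w" "w 0 = f" using profile_tower_exists[OF fI] by blast
    have "f differentiable (at x within {0..r})" if "x \<in> {0..r}" for x
      using fI that unfolding C_infinity_Icc_def nth_deriv_Icc_def by (auto dest!: spec[of _ 0])
    then have "continuous_on {0..r} (w 0)"
      unfolding w(2) continuous_on_eq_continuous_within
      by (blast intro: differentiable_imp_continuous_within)
    then obtain g Bg where g: "profile_tower r (case_nat g w)" "\<And>\<rho>. \<rho> \<in> {0<..<r} \<Longrightarrow> norm (g \<rho>) \<le> Bg"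
      using profile_tower_primitive[OF w(1) r] by blast
    have FW: "F x $ i = radial_deriv (case_nat g w) (\<lambda>j. if j = i then 1 else 0) x"
      if "x \<in> ball 0 r - {0}" for i x
      using cor that by (simp add: radial_deriv_unit corotational_with_profile_def w(2) scaleR_conv_of_real)
    have bW: "bounded_tower r (case_nat g w)"
      unfolding bounded_tower_def
    proof
      fix m
      show "\<exists>B. \<forall>\<rho>\<in>{0<..<r}. norm (case_nat g w m \<rho>) \<le> B"
      proof (cases "m = 0")
        case True
        then show ?thesis using g(2) by (intro exI[of _ Bg]) auto
      next
        case False
        then show ?thesis using corotational_tower_bounded[OF assms(1) F g(1) _ FW] by blast
      qed
    qed
    then have bw: "bounded_tower r w" by (rule tower_tail)
    define S where "S = (sobolev_norm k r (\<lambda>y::real^'e. f (norm y)))\<^sup>2"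
    define T where "T = (sobolev_norm_map k r F)\<^sup>2"
    define Ew where "Ew = (\<Sum>n\<le>k. energy_integral r (CARD('d) + 1) w n)"
    define EW where "EW = (\<Sum>n\<in>{1..Suc k}. energy_integral r (CARD('d) - 1) (case_nat g w) n)"
    have S: "c1 * Ew \<le> S" "S \<le> C1 * Ew"
      using 1(3)[OF w(1) bw] unfolding S_def Ew_def e_eq w(2) by auto
    have T: "c2 * EW \<le> T" "T \<le> C2 * EW"
      using 2(3)[OF g(1) bW] FW unfolding T_def EW_def by blast+
    have E: "Ew \<le> EW" "EW \<le> A * Ew"
      using A(2)[OF g(1) bW] unfolding Ew_def EW_def by auto
    have "c2 / C1 * S \<le> c2 * Ew"
    proof -
      have "c2 / C1 * S \<le> c2 / C1 * (C1 * Ew)" using S(2) 1 2 by (intro mult_left_mono) auto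
      then show ?thesis using 1 by simp
    qed
    also have "\<dots> \<le> c2 * EW" using E(1) 2 by simp
    also have "\<dots> \<le> T" by (rule T(1))
    finally have lower: "c2 / C1 * S \<le> T" .
    have "T \<le> C2 * (A * Ew)" using T(2) E(2) 2(2) by (meson less_imp_le mult_left_mono order_trans)
    also have "Ew \<le> S / c1" using S(1) 1(1) by (simp add: field_simps)
    then have "C2 * (A * Ew) \<le> C2 * (A * (S / c1))" using A(1) 2(2) by (intro mult_left_mono) auto
    finally have upper: "T \<le> C2 * A / c1 * S" by simp
    show ?thesis using lower upper unfolding S_def T_def by simp
  qed
  have nonneg: "sobolev_norm k r (u :: real^'e \<Rightarrow> complex) \<ge> 0" "sobolev_norm_map k r (F :: real^'d \<Rightarrow> complex^'d) \<ge> 0" for u F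
    by (simp_all add: sobolev_norm_def sobolev_norm_map_def sum_nonneg)
  have "sqrt (c2 / C1) * sobolev_norm k r (\<lambda>y::real^'e. f (norm y)) \<le> sobolev_norm_map k r F \<and>
      sobolev_norm_map k r F \<le> sqrt (C2 * A / c1) * sobolev_norm k r (\<lambda>y::real^'e. f (norm y))"
    if "F \<in> C_infinity_cball_map r" "f \<in> C_infinity_ev r" "corotational_with_profile r F f"
    for F :: "real^'d \<Rightarrow> complex^'d" and f
    using sq[OF that, THEN conjunct1, THEN real_sqrt_le_mono]
      sq[OF that, THEN conjunct2, THEN real_sqrt_le_mono]
    by (simp only: real_sqrt_mult real_sqrt_abs abs_of_nonneg[OF nonneg(1)] abs_of_nonneg[OF nonneg(2)])
  moreover have "sqrt (c2 / C1) > 0" "sqrt (C2 * A / c1) > 0" using 1 2 A by auto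
  ultimately show ?thesis by blast
qed

end
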